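(* Assume that $f_1$ satisfies $f_1(0)=f_1(K_1)=0$, $0<f_1(s)\le f_1'(0)s$ for $s\in(0,K_1)$, $f_1'(K_1)<0$, $f_1<0$ in $(-\infty,0)\cup(K_1,+\infty)$; and that, for some $\theta\in(0,K_2)$, $f_2(0)=f_2(\theta)=f_2(K_2)=0$, $f_2'(0)<0$, $f_2'(\theta)>0$, $f_2'(K_2)<0$, $f_2<0$ in $(0,\theta)\cup(K_2,+\infty)$, $f_2>0$ in $(-\infty,0)\cup(\theta,K_2)$. Let $u$ be the solution of (P) with a nonnegative continuous and compactly supported initial datum $u_0$. Then $u$ is blocked in patch 2, that is, $$u(t,x)\to0\ \text{ as }x\to+\infty,\ \text{ uniformly in }t\ge0,$$ if one of the following conditions is satisfied: (i) either $\int_0^{K_2}f_2(s)\,\mathrm{d}s<0$; (ii) or $\int_0^{K_2}f_2(s)\,\mathrm{d}s=0$ and $K_1<K_2$; (iii) or $K_1<\theta$ and $u_0<\theta$ in $\mathbb{R}$; (iv) or (P) admits a nonnegative classical stationary solution $U$ with $U(-\infty)=K_1$ and $U(+\infty)=0$, and $\|u_0\|_{L^1(\mathbb{R})}\le\varepsilon$, for some $\varepsilon>0$ depending on $f_1,f_2,d_1,d_2$, $U$ and $L$, where $L>0$ is such that the support of $u_0$ is included in $[-L,L]$ (i.e. given such a $U$ and any $L>0$, there is $\varepsilon>0$ depending only on these data such that blocking holds for all such $u_0$ with support in $[-L,L]$ and $\|u_0\|_{L^1(\mathbb{R})}\le\varepsilon$).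
   Context: Setting. Let $d_1,d_2,\sigma>0$ and let $f_1,f_2\in C^1(\mathbb{R})$, with constants $K_1,K_2>0$. Put $I_1=(-\infty,0)$ (patch 1), $I_2=(0,+\infty)$ (patch 2). Problem (P) is $$\begin{cases}u_t=d_1u_{xx}+f_1(u),& t>0,\ x<0,\\ u_t=d_2u_{xx}+f_2(u),& t>0,\ x>0,\\ u(t,0^-)=u(t,0^+),& t>0,\\ u_x(t,0^-)=\sigma u_x(t,0^+),& t>0,\end{cases}$$ with initial condition $u(0,\cdot)=u_0$. A classical solution is a continuous $u:[0,+\infty)\times\mathbb{R}\to\mathbb{R}$ with $u(0,\cdot)=u_0$, such that for $i=1,2$ the restriction of $u$ to $(0,+\infty)\times\overline{I_i}$ is $C^1$ in $t$ and $C^2$ in $x$ (up to $x=0$), and all identities in (P) hold pointwise. For every nonnegative bounded continuous $u_0$ there is a unique nonnegative bounded classical solution, called the solution of (P) with initial datum $u_0$. A classical stationary solution of (P) is a continuous $U:\mathbb{R}\to\mathbb{R}$ with $U|_{\overline{I_i}}\in C^2(\overline{I_i})$ satisfying the (time-independent) identities of (P) pointwise, i.e. $d_iU''+f_i(U)=0$ in $I_i$ and $U'(0^-)=\sigma U'(0^+)$. *)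

theory Defs
  imports "HOL-Analysis.Analysis"
begin

text \<open>
  Derivatives are taken within the closed half-line \<open>S\<close> (\<open>{..0}\<close> or \<open>{0..}\<close>), so at the
  interface point \<open>0\<close> they are one-sided.  They are unique there, hence the functions
  \<open>g'\<close>, \<open>g''\<close>, \<open>ut\<close>, \<open>ux\<close>, \<open>uxx\<close> below are determined by \<open>g\<close> resp. \<open>u\<close>.
\<close>

definition C2_derivs ::
  "real set \<Rightarrow> (real \<Rightarrow> real) \<Rightarrow> (real \<Rightarrow> real) \<Rightarrow> (real \<Rightarrow> real) \<Rightarrow> bool"
where
  "C2_derivs S g g' g'' \<longleftrightarrow>
     (\<forall>x\<in>S. (g has_real_derivative g' x) (at x within S)) \<and>
     (\<forall>x\<in>S. (g' has_real_derivative g'' x) (at x within S)) \<and>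
     continuous_on S g''"

text \<open>
  Regularity \<open>C\<^sup>1\<close> in \<open>t\<close> and \<open>C\<^sup>2\<close> in \<open>x\<close> on \<open>(0, \<infinity>) \<times> S\<close>, in the usual parabolic
  sense: the derivatives are jointly continuous in \<open>(t, x)\<close>.
\<close>

definition C12_derivs ::
  "real set \<Rightarrow> (real \<Rightarrow> real \<Rightarrow> real) \<Rightarrow>
   (real \<Rightarrow> real \<Rightarrow> real) \<Rightarrow> (real \<Rightarrow> real \<Rightarrow> real) \<Rightarrow> (real \<Rightarrow> real \<Rightarrow> real) \<Rightarrow> bool"
where
  "C12_derivs S u ut ux uxx \<longleftrightarrow>
     (\<forall>t>0. \<forall>x\<in>S. ((\<lambda>s. u s x) has_real_derivative ut t x) (at t)) \<and>
     (\<forall>t>0. \<forall>x\<in>S. (u t has_real_derivative ux t x) (at x within S)) \<and>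
     (\<forall>t>0. \<forall>x\<in>S. (ux t has_real_derivative uxx t x) (at x within S)) \<and>
     continuous_on ({0<..} \<times> S) (\<lambda>(t, x). ut t x) \<and>
     continuous_on ({0<..} \<times> S) (\<lambda>(t, x). ux t x) \<and>
     continuous_on ({0<..} \<times> S) (\<lambda>(t, x). uxx t x)"

text \<open>
  The interface condition \<open>u(t,0\<^sup>-) = u(t,0\<^sup>+)\<close> is part of the continuity of \<open>u\<close>.  Values
  \<open>u t x\<close> for \<open>t < 0\<close> are irrelevant.
\<close>

definition classical_solution ::
  "real \<Rightarrow> real \<Rightarrow> real \<Rightarrow> (real \<Rightarrow> real) \<Rightarrow> (real \<Rightarrow> real) \<Rightarrow>
   (real \<Rightarrow> real) \<Rightarrow> (real \<Rightarrow> real \<Rightarrow> real) \<Rightarrow> bool"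
where
  "classical_solution d1 d2 \<sigma> f1 f2 u0 u \<longleftrightarrow>
     continuous_on ({0..} \<times> UNIV) (\<lambda>(t, x). u t x) \<and>
     (\<forall>x. u 0 x = u0 x) \<and>
     (\<exists>ut1 ux1 uxx1 ut2 ux2 uxx2.
        C12_derivs {..0} u ut1 ux1 uxx1 \<and>
        C12_derivs {0..} u ut2 ux2 uxx2 \<and>
        (\<forall>t>0. \<forall>x<0. ut1 t x = d1 * uxx1 t x + f1 (u t x)) \<and>
        (\<forall>t>0. \<forall>x>0. ut2 t x = d2 * uxx2 t x + f2 (u t x)) \<and>
        (\<forall>t>0. ux1 t 0 = \<sigma> * ux2 t 0))"

text \<open>
  Solutions of the Cauchy problem are understood in the class of nonnegative bounded classical
  solutions, in which they are unique.
\<close>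

definition solution_of_P ::
  "real \<Rightarrow> real \<Rightarrow> real \<Rightarrow> (real \<Rightarrow> real) \<Rightarrow> (real \<Rightarrow> real) \<Rightarrow>
   (real \<Rightarrow> real) \<Rightarrow> (real \<Rightarrow> real \<Rightarrow> real) \<Rightarrow> bool"
where
  "solution_of_P d1 d2 \<sigma> f1 f2 u0 u \<longleftrightarrow>
     classical_solution d1 d2 \<sigma> f1 f2 u0 u \<and>
     (\<forall>t\<ge>0. \<forall>x. 0 \<le> u t x) \<and>
     (\<exists>M. \<forall>t\<ge>0. \<forall>x. u t x \<le> M)"

definition classical_stationary_solution ::
  "real \<Rightarrow> real \<Rightarrow> real \<Rightarrow> (real \<Rightarrow> real) \<Rightarrow> (real \<Rightarrow> real) \<Rightarrow> (real \<Rightarrow> real) \<Rightarrow> bool"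
where
  "classical_stationary_solution d1 d2 \<sigma> f1 f2 U \<longleftrightarrow>
     continuous_on UNIV U \<and>
     (\<exists>U1' U1'' U2' U2''.
        C2_derivs {..0} U U1' U1'' \<and>
        C2_derivs {0..} U U2' U2'' \<and>
        (\<forall>x<0. d1 * U1'' x + f1 (U x) = 0) \<and>
        (\<forall>x>0. d2 * U2'' x + f2 (U x) = 0) \<and>
        U1' 0 = \<sigma> * U2' 0)"

definition admissible_datum :: "(real \<Rightarrow> real) \<Rightarrow> bool" where
  "admissible_datum u0 \<longleftrightarrow>
     continuous_on UNIV u0 \<and> (\<forall>x. 0 \<le> u0 x) \<and> compact (closure {x. u0 x \<noteq> 0})"

definition blocked_in_patch_2 :: "(real \<Rightarrow> real \<Rightarrow> real) \<Rightarrow> bool" where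
  "blocked_in_patch_2 u \<longleftrightarrow> uniform_limit {0..} (\<lambda>x t. u t x) (\<lambda>t. 0) at_top"

end

theory Submission
  imports Defs
begin

text \<open>
  Everything rests on the comparison principle: a nonnegative supersolution \<open>w\<close> lying above \<open>u\<close>
  at one time stays above \<open>u\<close> at all later times. A supersolution may be assembled from smooth
  pieces: a concave corner is harmless away from the interface, and at the interface the only
  requirement is \<open>w\<^sub>x(0\<^sup>-) \<ge> \<sigma> w\<^sub>x(0\<^sup>+)\<close>. In particular a function that is constant in
  patch 1 and nonincreasing in patch 2 always matches correctly, whatever \<open>\<sigma>\<close> is. Each part of the theorem
  is a choice of \<open>w\<close> that tends to 0 at \<open>+\<infinity>\<close>. Decay that is uniform only for large times suffices,
  because up to any finite time \<open>u\<close> is dominated by \<open>A exp (- x)\<close> in patch 2.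

  Let \<open>F(s) = \<integral>\<^sub>0\<^sup>s f\<^sub>2\<close>. Where \<open>F < 0\<close>, the equation \<open>\<phi>' = - sqrt (- 2 F(\<phi>) / d\<^sub>2)\<close> produces
  decreasing solutions of \<open>d\<^sub>2 \<phi>'' + f\<^sub>2(\<phi>) = 0\<close> of zero energy that vanish at \<open>+\<infinity>\<close>.

  \<^item> If the integral of \<open>f\<^sub>2\<close> over \<open>[0, K\<^sub>2]\<close> is negative, then \<open>F < 0\<close> on all of \<open>(0, \<infinity>)\<close>. If
    \<open>K\<^sub>1 < \<theta>\<close> and \<open>u\<^sub>0 < \<theta>\<close>, then \<open>F < 0\<close> on \<open>(0, \<theta>)\<close>. In both cases there is a level \<open>M \<ge> u\<^sub>0\<close>
    with \<open>f\<^sub>1(M), f\<^sub>2(M) \<le> 0\<close> and \<open>F < 0\<close> on \<open>(0, M]\<close>; the stationary barrier equals \<open>M\<close> up to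
    the right end of the support of \<open>u\<^sub>0\<close> and follows \<open>\<phi>\<close> from there on.
  \<^item> If the integral vanishes and \<open>K\<^sub>1 < K\<^sub>2\<close>, then \<open>\<phi>\<close> is a standing wave joining \<open>K\<^sub>2\<close> to 0. After
    \<open>u\<close> has dropped below \<open>K\<^sub>2\<close> plus a small amount, a Fife--McLeod supersolution
    \<open>\<phi>(x - \<xi>(t)) + q(t)\<close> with \<open>q\<close> exponentially small and \<open>\<xi>\<close> bounded controls patch 2, and its
    trace at 0 controls patch 1, where \<open>f\<^sub>1 < 0\<close> near \<open>K\<^sub>2\<close>.
  \<^item> If a stationary solution \<open>U\<close> exists, it is itself the barrier once \<open>u \<le> U\<close> at time 1. Since
    \<open>U\<close> decays at most exponentially, it suffices to bound \<open>u(1, \<cdot>)\<close> by a small multiple of a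
    Gaussian. In the variable \<open>x / sqrt d\<^sub>i\<close> both patches have the same heat equation, and an even
    solution of it has zero slope at the interface, so it is admissible for every \<open>\<sigma>\<close>. An even
    finite sum of Gaussians dominating \<open>u\<^sub>0\<close>, of mass comparable to the \<open>L\<^sup>1\<close> norm of \<open>u\<^sub>0\<close>, does it
    with a bound that does not involve \<open>\<sigma>\<close>.
\<close>

section \<open>Calculus on the line\<close>

lemma C1_real_derivative:
  fixes f :: "real \<Rightarrow> real"
  assumes "f C1_differentiable_on UNIV"
  obtains f' where "\<And>x. (f has_real_derivative f' x) (at x)" "continuous_on UNIV f'"
  using assms unfolding C1_differentiable_on_def has_real_derivative_iff_has_vector_derivative by auto

lemma C1_Lipschitz_on_interval:
  fixes f :: "real \<Rightarrow> real"
  assumes "f C1_differentiable_on UNIV"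
  obtains L where "L \<ge> 0" "\<And>x y. x \<in> {a..b} \<Longrightarrow> y \<in> {a..b} \<Longrightarrow> \<bar>f x - f y\<bar> \<le> L * \<bar>x - y\<bar>"
proof -
  obtain f' where f': "\<And>x. (f has_real_derivative f' x) (at x)" "continuous_on UNIV f'"
    using C1_real_derivative[OF assms] by blast
  have "compact (f' ` {a..b})"
    using f'(2) compact_continuous_image continuous_on_subset by blast
  then obtain L where L: "L > 0" "\<And>x. x \<in> {a..b} \<Longrightarrow> \<bar>f' x\<bar> \<le> L"
    using compact_imp_bounded bounded_pos by (metis image_eqI real_norm_def)
  have "\<bar>f x - f y\<bar> \<le> L * \<bar>x - y\<bar>" if "x \<in> {a..b}" "y \<in> {a..b}" for x y
    using field_differentiable_bound[of "{a..b}" f f' L x y] L that f'(1)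
    by (simp add: has_field_derivative_at_within)
  then show thesis using that[of L] L by auto
qed

text \<open>
  A relation at a single point: only there is the second derivative required, while the first
  derivative must exist nearby. This lets functions glued from smooth pieces be treated piece by
  piece, and no derivative functions need to be carried along with a supersolution.
\<close>

definition has_second_derivative :: "(real \<Rightarrow> real) \<Rightarrow> real \<Rightarrow> real \<Rightarrow> bool" where
  "has_second_derivative f D x \<longleftrightarrow>
     (\<exists>f'. (\<forall>\<^sub>F y in nhds x. (f has_real_derivative f' y) (at y)) \<and>
           (f' has_real_derivative D) (at x))"

lemma has_second_derivativeI:
  assumes "\<And>y. y \<in> S \<Longrightarrow> (f has_real_derivative f' y) (at y)" "open S" "x \<in> S"
    "(f' has_real_derivative D) (at x)"
  shows "has_second_derivative f D x"
  unfolding has_second_derivative_def using assms eventually_nhds by blast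

lemma has_second_derivative_diff:
  assumes "has_second_derivative f D x" "has_second_derivative g E x"
  shows "has_second_derivative (\<lambda>x. f x - g x) (D - E) x"
proof -
  obtain f' g' where f: "\<forall>\<^sub>F y in nhds x. (f has_real_derivative f' y) (at y)" "(f' has_real_derivative D) (at x)"
    and g: "\<forall>\<^sub>F y in nhds x. (g has_real_derivative g' y) (at y)" "(g' has_real_derivative E) (at x)"
    using assms unfolding has_second_derivative_def by blast
  have "\<forall>\<^sub>F y in nhds x. ((\<lambda>x. f x - g x) has_real_derivative f' y - g' y) (at y)"
    using f(1) g(1) by eventually_elim (rule DERIV_diff)
  moreover have "((\<lambda>y. f' y - g' y) has_real_derivative D - E) (at x)"
    using f(2) g(2) by (rule DERIV_diff)
  ultimately show ?thesis
    unfolding has_second_derivative_def by (intro exI[of _ "\<lambda>y. f' y - g' y"] conjI)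
qed

lemma has_second_derivative_cmult:
  assumes "has_second_derivative f D x"
  shows "has_second_derivative (\<lambda>x. c * f x) (c * D) x"
proof -
  obtain f' where f: "\<forall>\<^sub>F y in nhds x. (f has_real_derivative f' y) (at y)" "(f' has_real_derivative D) (at x)"
    using assms unfolding has_second_derivative_def by blast
  have "\<forall>\<^sub>F y in nhds x. ((\<lambda>x. c * f x) has_real_derivative c * f' y) (at y)"
    using f(1) by eventually_elim (rule DERIV_cmult)
  then show ?thesis
    unfolding has_second_derivative_def using DERIV_cmult[OF f(2)] by (intro exI[of _ "\<lambda>y. c * f' y"] conjI)
qed

lemma has_second_derivative_transform:
  assumes "has_second_derivative f D x" "\<forall>\<^sub>F y in nhds x. f y = g y"
  shows "has_second_derivative g D x"
proof -
  obtain f' where f: "\<forall>\<^sub>F y in nhds x. (f has_real_derivative f' y) (at y)" "(f' has_real_derivative D) (at x)"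
    using assms unfolding has_second_derivative_def by blast
  have "\<forall>\<^sub>F y in nhds x. \<forall>\<^sub>F z in nhds y. f z = g z"
    using assms(2) by (simp add: eventually_eventually)
  with f(1) have "\<forall>\<^sub>F y in nhds x. (g has_real_derivative f' y) (at y)"
    by eventually_elim (metis DERIV_cong_ev)
  then show ?thesis unfolding has_second_derivative_def using f(2) by blast
qed

lemma second_derivative_nonpos_at_max:
  assumes "has_second_derivative f D x" "\<And>y. f y \<le> f x"
  shows "D \<le> 0"
proof (rule ccontr)
  assume "\<not> D \<le> 0"
  obtain f' where f: "\<forall>\<^sub>F y in nhds x. (f has_real_derivative f' y) (at y)" "(f' has_real_derivative D) (at x)"
    using assms unfolding has_second_derivative_def by blast
  then obtain e where e: "e > 0" "\<And>y. \<bar>y - x\<bar> < e \<Longrightarrow> (f has_real_derivative f' y) (at y)"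
    unfolding eventually_nhds_metric dist_real_def by blast
  have "f' x = 0"
    using DERIV_local_max[OF e(2)[of x], of 1] e(1) assms(2) by simp
  then obtain d where d: "d > 0" "\<And>h. 0 < h \<Longrightarrow> h < d \<Longrightarrow> 0 < f' (x + h)"
    using DERIV_pos_inc_right[OF f(2)] \<open>\<not> D \<le> 0\<close> by (metis not_le)
  define h where "h = min d e / 2"
  have h: "0 < h" "h < d" "h < e" using d(1) e(1) by (auto simp: h_def)
  obtain z where z: "x < z" "z < x + h" "f (x + h) - f x = (x + h - x) * f' z"
    using MVT2[of x "x + h" f f'] e(2) h by force
  have "0 < f' z" using d(2)[of "z - x"] z h by simp
  then have "0 < (x + h - x) * f' z" using h by (intro mult_pos_pos) auto
  then have "f x < f (x + h)" using z(3) by simp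
  then show False using assms(2)[of "x + h"] by simp
qed

lemma left_derivative_nonneg_at_max:
  assumes "(f has_real_derivative D) (at x within {..x})" "\<And>y. e < y \<Longrightarrow> y \<le> x \<Longrightarrow> f y \<le> f x" "e < x"
  shows "D \<ge> 0"
proof (rule ccontr)
  assume "\<not> D \<ge> 0"
  then obtain d where d: "d > 0" "\<And>h. h > 0 \<Longrightarrow> h < d \<Longrightarrow> f x < f (x - h)"
    using has_real_derivative_neg_dec_left[OF assms(1)] by force
  define h where "h = min d (x - e) / 2"
  have "h > 0" "h < d" "e < x - h" using d(1) assms(3) by (auto simp: h_def min_def field_simps)
  then show False using d(2)[of h] assms(2)[of "x - h"] by force
qed

lemma right_derivative_nonpos_at_max:
  assumes "(f has_real_derivative D) (at x within {x..})" "\<And>y. x \<le> y \<Longrightarrow> f y \<le> f x"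
  shows "D \<le> 0"
proof (rule ccontr)
  assume "\<not> D \<le> 0"
  then obtain d where d: "d > 0" "\<And>h. h > 0 \<Longrightarrow> h < d \<Longrightarrow> f x < f (x + h)"
    using has_real_derivative_pos_inc_right[OF assms(1)] by force
  have "f x < f (x + d / 2)" using d by simp
  then show False using assms(2)[of "x + d / 2"] d(1) by simp
qed

section \<open>Supersolutions and the comparison principle\<close>

lemma classical_solution_in_patch:
  assumes "classical_solution d1 d2 \<sigma> f1 f2 u0 u" "t > 0" "x \<noteq> 0"
  obtains D D2 where "((\<lambda>s. u s x) has_real_derivative D) (at t)" "has_second_derivative (u t) D2 x"
    "D = (if x < 0 then d1 else d2) * D2 + (if x < 0 then f1 else f2) (u t x)"
proof -
  obtain ut1 ux1 uxx1 ut2 ux2 uxx2 where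
    C: "C12_derivs {..0} u ut1 ux1 uxx1" "C12_derivs {0..} u ut2 ux2 uxx2"
    and E: "\<And>t x. t > 0 \<Longrightarrow> x < 0 \<Longrightarrow> ut1 t x = d1 * uxx1 t x + f1 (u t x)"
      "\<And>t x. t > 0 \<Longrightarrow> x > 0 \<Longrightarrow> ut2 t x = d2 * uxx2 t x + f2 (u t x)"
    using assms(1) unfolding classical_solution_def by blast
  have i: "at y within {..0} = at y" if "y < 0" for y :: real
    using that by (intro at_within_interior) (simp)
  have j: "at y within {0..} = at y" if "y > 0" for y :: real
    using that by (intro at_within_interior) simp
  have 1: "((\<lambda>s. u s y) has_real_derivative ut1 t y) (at t)" "(u t has_real_derivative ux1 t y) (at y)"
    "(ux1 t has_real_derivative uxx1 t y) (at y)" if "y < 0" for y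
    using C(1) that assms(2) i[OF that] unfolding C12_derivs_def by (metis atMost_iff less_imp_le)+
  have 2: "((\<lambda>s. u s y) has_real_derivative ut2 t y) (at t)" "(u t has_real_derivative ux2 t y) (at y)"
    "(ux2 t has_real_derivative uxx2 t y) (at y)" if "y > 0" for y
    using C(2) that assms(2) j[OF that] unfolding C12_derivs_def by (metis atLeast_iff less_imp_le)+
  show thesis
  proof (cases "x < 0")
    case True
    have "has_second_derivative (u t) (uxx1 t x) x"
      by (rule has_second_derivativeI[of "{..<0}" _ "ux1 t"]) (use 1 True in simp_all)
    then show ?thesis using that[OF 1(1)] E(1) assms(2) True by simp
  next
    case False
    then have x: "x > 0" using assms(3) by simp
    have "has_second_derivative (u t) (uxx2 t x) x"
      by (rule has_second_derivativeI[of "{0<..}" _ "ux2 t"]) (use 2 x in simp_all)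
    then show ?thesis using that[OF 2(1)] E(2) assms(2) x by simp
  qed
qed

lemma classical_solution_at_interface:
  assumes "classical_solution d1 d2 \<sigma> f1 f2 u0 u" "t > 0"
  obtains a b where "(u t has_real_derivative a) (at 0 within {..0})"
    "(u t has_real_derivative b) (at 0 within {0..})" "a = \<sigma> * b"
proof -
  obtain ut1 ux1 uxx1 ut2 ux2 uxx2 where
    C: "C12_derivs {..0} u ut1 ux1 uxx1" "C12_derivs {0..} u ut2 ux2 uxx2"
    and E: "ux1 t 0 = \<sigma> * ux2 t 0"
    using assms unfolding classical_solution_def by blast
  show thesis
    by (rule that[OF _ _ E]) (use C assms(2) in \<open>auto simp: C12_derivs_def\<close>)
qed

text \<open>
  The piecewise notion of supersolution: every point is either a smooth point of one of the two
  open patches, or a corner across which the slope jumps in the favourable direction. A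
  subsolution cannot touch such a corner from below. At the interface the slopes are weighted with
  \<open>\<sigma>\<close> and equality is allowed, since this is the transmission condition itself.
\<close>

definition supersolution_at ::
  "real \<Rightarrow> real \<Rightarrow> (real \<Rightarrow> real) \<Rightarrow> (real \<Rightarrow> real) \<Rightarrow> (real \<Rightarrow> real \<Rightarrow> real) \<Rightarrow> real \<Rightarrow> real \<Rightarrow> bool" where
  "supersolution_at d1 d2 f1 f2 w t x \<longleftrightarrow> x \<noteq> 0 \<and>
     (\<exists>D D2. ((\<lambda>s. w s x) has_real_derivative D) (at t) \<and> has_second_derivative (w t) D2 x \<and>
        (if x < 0 then d1 else d2) * D2 + (if x < 0 then f1 else f2) (w t x) \<le> D)"

definition concave_corner_at :: "real \<Rightarrow> (real \<Rightarrow> real) \<Rightarrow> real \<Rightarrow> bool" where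
  "concave_corner_at \<sigma> w x \<longleftrightarrow>
     (\<exists>a b. (w has_real_derivative a) (at x within {..x}) \<and>
            (w has_real_derivative b) (at x within {x..}) \<and>
            (if x = 0 then \<sigma> * b \<le> a else b < a))"

definition supersolution_on ::
  "real \<Rightarrow> real \<Rightarrow> real \<Rightarrow> (real \<Rightarrow> real) \<Rightarrow> (real \<Rightarrow> real) \<Rightarrow> real \<Rightarrow> real \<Rightarrow> (real \<Rightarrow> real \<Rightarrow> real) \<Rightarrow> bool"
where
  "supersolution_on d1 d2 \<sigma> f1 f2 t0 t1 w \<longleftrightarrow>
     continuous_on ({t0..t1} \<times> UNIV) (\<lambda>(t, x). w t x) \<and>
     (\<forall>t\<in>{t0..t1}. \<forall>x. 0 \<le> w t x) \<and>
     (\<forall>t\<in>{t0<..t1}. \<forall>x. supersolution_at d1 d2 f1 f2 w t x \<or> concave_corner_at \<sigma> (w t) x)"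

text \<open>
  Suppose \<open>u > w\<close> somewhere. Multiplying \<open>u - w\<close> by \<open>exp (- l t)\<close> absorbs the Lipschitz reaction
  term, and subtracting a small multiple \<open>\<eta>\<close> of a function \<open>P\<close> growing at infinity makes the
  positive maximum attained. At a smooth point the derivative conditions of a maximum contradict
  the differential inequalities; at a corner they contradict the slope condition. Wherever
  \<open>u > w \<ge> 0\<close>, both values lie in \<open>[0, M]\<close> for the upper bound \<open>M\<close> of \<open>u\<close>, and the Lipschitz constants
  of the reactions on \<open>[0, M]\<close> apply.
\<close>

theorem comparison_principle:
  fixes u w :: "real \<Rightarrow> real \<Rightarrow> real"
  assumes d: "0 < d1" "0 < d2" and \<sigma>: "0 < \<sigma>"
    and f: "f1 C1_differentiable_on UNIV" "f2 C1_differentiable_on UNIV"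
    and u: "solution_of_P d1 d2 \<sigma> f1 f2 u0 u"
    and w: "supersolution_on d1 d2 \<sigma> f1 f2 t0 t1 w"
    and t0: "0 \<le> t0" and init: "\<And>x. u t0 x \<le> w t0 x"
    and t: "t \<in> {t0..t1}"
  shows "u t x \<le> w t x"
proof -
  have cs: "classical_solution d1 d2 \<sigma> f1 f2 u0 u" and upos: "\<And>t x. t \<ge> 0 \<Longrightarrow> 0 \<le> u t x"
    using u unfolding solution_of_P_def by auto
  obtain M where M: "\<And>t x. t \<ge> 0 \<Longrightarrow> u t x \<le> M" using u unfolding solution_of_P_def by blast
  have M0: "0 \<le> M" using M[of 0] upos[of 0] by (meson order_refl order_trans)
  obtain L1 where L1: "L1 \<ge> 0" "\<And>x y. x \<in> {0..M} \<Longrightarrow> y \<in> {0..M} \<Longrightarrow> \<bar>f1 x - f1 y\<bar> \<le> L1 * \<bar>x - y\<bar>"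
    using C1_Lipschitz_on_interval[OF f(1)] by blast
  obtain L2 where L2: "L2 \<ge> 0" "\<And>x y. x \<in> {0..M} \<Longrightarrow> y \<in> {0..M} \<Longrightarrow> \<bar>f2 x - f2 y\<bar> \<le> L2 * \<bar>x - y\<bar>"
    using C1_Lipschitz_on_interval[OF f(2)] by blast
  have wpos: "\<And>t x. t \<in> {t0..t1} \<Longrightarrow> 0 \<le> w t x" using w unfolding supersolution_on_def by blast
  \<comment> \<open>The excess over the Lipschitz constants beats the error \<open>2 d \<eta>\<close> coming from \<open>P'' = 2\<close>, because
    \<open>P \<ge> 3/4\<close>.\<close>
  define l where "l = L1 + L2 + 3 * (d1 + d2)"
  have l: "l > 0" using d L1 L2 by (simp add: l_def)
  \<comment> \<open>The term \<open>min x 0\<close> gives \<open>P\<close> slope 1 on the left and 0 on the right of the interface. This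
    turns the non-strict transmission inequality into a strict one.\<close>
  define P :: "real \<Rightarrow> real" where "P = (\<lambda>x. x\<^sup>2 + min x 0 + 1)"
  have P34: "P x \<ge> 3/4" for x
  proof -
    have "0 \<le> (x + 1/2)\<^sup>2" by simp
    then show ?thesis by (auto simp: P_def min_def power2_eq_square algebra_simps)
  qed
  have Pcont: "continuous_on UNIV P" unfolding P_def by (intro continuous_intros)
  have P2: "has_second_derivative P 2 x" if "x \<noteq> 0" for x
  proof (cases "x < 0")
    case True
    have "has_second_derivative (\<lambda>x. x\<^sup>2 + x + 1) 2 x"
      by (rule has_second_derivativeI[of UNIV _ "\<lambda>x. 2 * x + 1"]) (auto intro!: derivative_eq_intros)
    moreover have "\<forall>\<^sub>F y in nhds x. y\<^sup>2 + y + 1 = P y"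
      using eventually_nhds_in_open[of "{..<0}" x] True
      by (auto simp: P_def elim!: eventually_mono)
    ultimately show ?thesis by (rule has_second_derivative_transform)
  next
    case False
    have "has_second_derivative (\<lambda>x::real. x\<^sup>2 + 1) 2 x"
      by (rule has_second_derivativeI[of UNIV _ "\<lambda>x. 2 * x"]) (auto intro!: derivative_eq_intros)
    moreover have "\<forall>\<^sub>F y in nhds x. y\<^sup>2 + 1 = P y"
      using eventually_nhds_in_open[of "{0<..}" x] False that
      by (auto simp: P_def elim!: eventually_mono)
    ultimately show ?thesis by (rule has_second_derivative_transform)
  qed
  have Pl: "(P has_real_derivative (if x \<le> 0 then 2 * x + 1 else 2 * x)) (at x within {..x})" for x
  proof (cases "x \<le> 0")
    case True
    have "((\<lambda>x. x\<^sup>2 + x + 1) has_real_derivative 2 * x + 1) (at x within {..x})"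
      by (auto intro!: derivative_eq_intros)
    then have "(P has_real_derivative 2 * x + 1) (at x within {..x})"
      by (rule has_field_derivative_transform_within[of _ _ _ _ 1]) (use True in \<open>auto simp: P_def\<close>)
    then show ?thesis using True by simp
  next
    case False
    have "((\<lambda>x::real. x\<^sup>2 + 1) has_real_derivative 2 * x) (at x within {..x})"
      by (auto intro!: derivative_eq_intros)
    then have "(P has_real_derivative 2 * x) (at x within {..x})"
      by (rule has_field_derivative_transform_within[of _ _ _ _ x]) (use False in \<open>auto simp: P_def dist_real_def\<close>)
    then show ?thesis using False by simp
  qed
  have Pr: "(P has_real_derivative (if x < 0 then 2 * x + 1 else 2 * x)) (at x within {x..})" for x
  proof (cases "x < 0")
    case True
    have "((\<lambda>x. x\<^sup>2 + x + 1) has_real_derivative 2 * x + 1) (at x within {x..})"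
      by (auto intro!: derivative_eq_intros)
    then have "(P has_real_derivative 2 * x + 1) (at x within {x..})"
      by (rule has_field_derivative_transform_within[of _ _ _ _ "-x"]) (use True in \<open>auto simp: P_def dist_real_def\<close>)
    then show ?thesis using True by simp
  next
    case False
    have "((\<lambda>x::real. x\<^sup>2 + 1) has_real_derivative 2 * x) (at x within {x..})"
      by (auto intro!: derivative_eq_intros)
    then have "(P has_real_derivative 2 * x) (at x within {x..})"
      by (rule has_field_derivative_transform_within[of _ _ _ _ 1]) (use False in \<open>auto simp: P_def dist_real_def\<close>)
    then show ?thesis using False by simp
  qed
  have key: "exp (- l * t) * (u t x - w t x) \<le> \<eta> * P x" if \<eta>: "\<eta> > 0" for \<eta>
  proof (rule ccontr)
    assume neg: "\<not> ?thesis"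
    define Z where "Z = (\<lambda>s y. exp (- l * s) * (u s y - w s y) - \<eta> * P y)"
    have Zpos: "Z t x > 0" using neg by (simp add: Z_def)
    have Zle: "Z s y \<le> M - \<eta> * P y" if "s \<in> {t0..t1}" for s y
    proof -
      have "u s y - w s y \<le> M" using M[of s y] wpos[OF that, of y] that t0 by auto
      moreover have "exp (- l * s) \<le> 1" using l that t0 by auto
      ultimately have "exp (- l * s) * (u s y - w s y) \<le> exp (- l * s) * M" "exp (- l * s) * M \<le> 1 * M"
        using M0 by (intro mult_left_mono mult_right_mono; simp)+
      then show ?thesis unfolding Z_def by linarith
    qed
    define \<rho> where "\<rho> = \<bar>x\<bar> + M / \<eta> + 2"
    have Zout: "Z s y \<le> 0" if "s \<in> {t0..t1}" "\<bar>y\<bar> \<ge> \<rho>" for s y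
    proof -
      have "M / \<eta> \<ge> 0" using M0 \<eta> by simp
      then have "\<bar>y\<bar> \<ge> 2" "\<bar>y\<bar> - 1 \<ge> M / \<eta>" using that(2) unfolding \<rho>_def by linarith+
      moreover have "y\<^sup>2 \<ge> 2 * \<bar>y\<bar>" using \<open>\<bar>y\<bar> \<ge> 2\<close>
        using mult_right_mono[of 2 "\<bar>y\<bar>" "\<bar>y\<bar>"] by (simp add: power2_eq_square)
      ultimately have "P y \<ge> M / \<eta>" unfolding P_def min_def by (simp add: abs_if split: if_splits)
      then have "\<eta> * P y \<ge> M" using \<eta> by (simp add: field_simps)
      then show ?thesis using Zle[OF that(1), of y] by simp
    qed
    have "continuous_on ({t0..t1} \<times> UNIV) (\<lambda>(s, y). u s y)"
      using cs t0 unfolding classical_solution_def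
      by (auto intro: continuous_on_subset)
    moreover have "continuous_on ({t0..t1} \<times> UNIV) (\<lambda>(s, y). w s y)"
      using w unfolding supersolution_on_def by blast
    moreover have "continuous_on ({t0..t1} \<times> UNIV) (\<lambda>(s::real, y). P y)"
      unfolding split_beta by (rule continuous_on_compose2[OF Pcont]) (auto intro!: continuous_intros)
    ultimately have "continuous_on ({t0..t1} \<times> UNIV) (\<lambda>p. Z (fst p) (snd p))"
      unfolding Z_def split_beta by (intro continuous_intros)
    then have "continuous_on ({t0..t1} \<times> {-\<rho>..\<rho>}) (\<lambda>p. Z (fst p) (snd p))"
      by (rule continuous_on_subset) auto
    moreover have "compact ({t0..t1} \<times> {-\<rho>..\<rho>})" by (intro compact_Times) auto
    moreover have txin: "(t, x) \<in> {t0..t1} \<times> {-\<rho>..\<rho>}"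
    proof -
      have "\<bar>x\<bar> \<le> \<rho>" using M0 \<eta> divide_nonneg_pos[of M \<eta>] by (simp add: \<rho>_def)
      then show ?thesis using t by (simp add: abs_le_iff)
    qed
    ultimately obtain p where p: "p \<in> {t0..t1} \<times> {-\<rho>..\<rho>}"
      "\<And>q. q \<in> {t0..t1} \<times> {-\<rho>..\<rho>} \<Longrightarrow> Z (fst q) (snd q) \<le> Z (fst p) (snd p)"
      using continuous_attains_sup[of "{t0..t1} \<times> {-\<rho>..\<rho>}" "\<lambda>p. Z (fst p) (snd p)"] by blast
    obtain s y where sy: "p = (s, y)" by (cases p)
    have s: "s \<in> {t0..t1}" using p(1) sy by auto
    have Zs: "Z s y > 0" using p(2)[OF txin] Zpos sy by simp
    have max: "Z r z \<le> Z s y" if "r \<in> {t0..t1}" for r z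
      using p(2)[of "(r, z)"] Zout[OF that, of z] Zs sy that by (cases "\<bar>z\<bar> \<le> \<rho>") (auto simp: abs_le_iff)
    have "s \<noteq> t0"
    proof
      assume "s = t0"
      then have "exp (- l * s) * (u s y - w s y) \<le> 0"
        using init[of y] by (simp add: mult_nonneg_nonpos)
      moreover have "\<eta> * P y > 0" using \<eta> P34[of y] by simp
      ultimately show False using Zs by (simp add: Z_def)
    qed
    then have s0: "s > t0" "s \<in> {t0<..t1}" using s by auto
    then have spos: "s > 0" using t0 by simp
    consider (interior) "supersolution_at d1 d2 f1 f2 w s y" | (corner) "concave_corner_at \<sigma> (w s) y"
      using w s0(2) unfolding supersolution_on_def by blast
    then show False
    proof cases
      case interior
      then obtain D D2 where y0: "y \<noteq> 0" and wd: "((\<lambda>r. w r y) has_real_derivative D) (at s)"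
        "has_second_derivative (w s) D2 y"
        "(if y < 0 then d1 else d2) * D2 + (if y < 0 then f1 else f2) (w s y) \<le> D"
        unfolding supersolution_at_def by blast
      obtain E E2 where ud: "((\<lambda>r. u r y) has_real_derivative E) (at s)"
        "has_second_derivative (u s) E2 y"
        "E = (if y < 0 then d1 else d2) * E2 + (if y < 0 then f1 else f2) (u s y)"
        using classical_solution_in_patch[OF cs spos y0] by blast
      define k where "k = exp (- l * s)"
      define z where "z = u s y - w s y"
      define \<delta> where "\<delta> = (if y < 0 then d1 else d2)"
      have k: "k > 0" by (simp add: k_def)
      have "has_second_derivative (\<lambda>x. k * (u s x - w s x) - \<eta> * P x) (k * (E2 - D2) - \<eta> * 2) y"
        by (intro has_second_derivative_diff has_second_derivative_cmult wd ud P2 y0)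
      then have xx: "k * (E2 - D2) - \<eta> * 2 \<le> 0"
        by (rule second_derivative_nonpos_at_max) (use max[OF s] in \<open>simp add: Z_def k_def\<close>)
      have "((\<lambda>r. Z r y) has_real_derivative k * (E - D) - l * k * z) (at s within {..s})"
        unfolding Z_def k_def z_def
        by (rule has_field_derivative_at_within) (auto intro!: derivative_eq_intros wd(1) ud(1) simp: algebra_simps)
      then have tt: "0 \<le> k * (E - D) - l * k * z"
        by (rule left_derivative_nonneg_at_max[where e = t0]) (use max s s0 in auto)
      have kz: "k * z > \<eta> * P y" using Zs by (simp add: Z_def k_def z_def)
      moreover have "\<eta> * P y \<ge> \<eta> * (3/4)" using \<eta> P34[of y] by simp
      ultimately have kz': "k * z > \<eta> * (3/4)" by simp
      then have z: "z > 0" using k \<eta> zero_less_mult_pos[of k z] by simp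
      have "u s y \<in> {0..M}" "w s y \<in> {0..M}"
        using upos[of s y] M[of s y] wpos[OF s, of y] z spos by (auto simp: z_def)
      then have "(if y < 0 then f1 else f2) (u s y) - (if y < 0 then f1 else f2) (w s y) \<le> (L1 + L2) * z"
        using L1(2)[of "u s y" "w s y"] L2(2)[of "u s y" "w s y"] z
          mult_nonneg_nonneg[OF L1(1), of z] mult_nonneg_nonneg[OF L2(1), of z]
        by (auto simp: z_def[symmetric] distrib_right abs_le_iff)
      then have "E - D \<le> \<delta> * (E2 - D2) + (L1 + L2) * z"
        using ud(3) wd(3) by (simp add: \<delta>_def algebra_simps split: if_splits)
      then have "k * (E - D) \<le> k * (\<delta> * (E2 - D2) + (L1 + L2) * z)"
        using k by simp
      also have "\<dots> = \<delta> * (k * (E2 - D2)) + (L1 + L2) * (k * z)" by (simp add: algebra_simps)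
      also have "\<dots> \<le> \<delta> * (\<eta> * 2) + (L1 + L2) * (k * z)"
        using xx d by (intro add_right_mono mult_left_mono) (auto simp: \<delta>_def)
      finally have "0 \<le> \<delta> * (\<eta> * 2) - 3 * (d1 + d2) * (k * z)"
        using tt by (simp add: l_def algebra_simps)
      moreover have "\<delta> * (\<eta> * 2) \<le> (d1 + d2) * (\<eta> * 2)"
        using d \<eta> by (intro mult_right_mono) (auto simp: \<delta>_def)
      moreover have "(d1 + d2) * (\<eta> * (3/4)) < (d1 + d2) * (k * z)"
        using kz' d by (intro mult_strict_left_mono) auto
      moreover have "0 < (d1 + d2) * \<eta>" using d \<eta> by simp
      ultimately show False by (simp add: algebra_simps)
    next
      case corner
      then obtain a b where wd: "(w s has_real_derivative a) (at y within {..y})"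
        "(w s has_real_derivative b) (at y within {y..})" "if y = 0 then \<sigma> * b \<le> a else b < a"
        unfolding concave_corner_at_def by blast
      obtain a' b' where ud: "(u s has_real_derivative a') (at y within {..y})"
        "(u s has_real_derivative b') (at y within {y..})" "if y = 0 then a' = \<sigma> * b' else a' = b'"
      proof (cases "y = 0")
        case True
        then show ?thesis using classical_solution_at_interface[OF cs spos] that by metis
      next
        case False
        obtain D2 where "has_second_derivative (u s) D2 y"
          using classical_solution_in_patch[OF cs spos False] by blast
        then obtain c where "(u s has_real_derivative c) (at y)"
          unfolding has_second_derivative_def using eventually_nhds_x_imp_x by blast
        then show ?thesis using that[of c c] False by (simp add: has_field_derivative_at_within)
      qed
      define k where "k = exp (- l * s)"
      have k: "k > 0" by (simp add: k_def)
      have "(Z s has_real_derivative k * (a' - a) - \<eta> * (if y \<le> 0 then 2 * y + 1 else 2 * y)) (at y within {..y})"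
        unfolding Z_def k_def by (intro DERIV_diff DERIV_cmult wd ud Pl)
      then have A: "0 \<le> k * (a' - a) - \<eta> * (if y \<le> 0 then 2 * y + 1 else 2 * y)"
        by (rule left_derivative_nonneg_at_max[where e = "y - 1"]) (use max[OF s] in auto)
      have "(Z s has_real_derivative k * (b' - b) - \<eta> * (if y < 0 then 2 * y + 1 else 2 * y)) (at y within {y..})"
        unfolding Z_def k_def by (intro DERIV_diff DERIV_cmult wd ud Pr)
      then have B: "k * (b' - b) - \<eta> * (if y < 0 then 2 * y + 1 else 2 * y) \<le> 0"
        by (rule right_derivative_nonpos_at_max) (use max[OF s] in auto)
      show False
      proof (cases "y = 0")
        case True
        then have 1: "\<eta> \<le> k * (a' - a)" and 2: "k * (b' - b) \<le> 0" using A B by auto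
        have "a' - a \<le> \<sigma> * (b' - b)" using wd(3) ud(3) True by (simp add: algebra_simps)
        moreover have "\<sigma> * (b' - b) \<le> 0"
          using 2 k \<sigma> by (simp add: mult_le_0_iff)
        ultimately have "a' - a \<le> 0" by simp
        then have "k * (a' - a) \<le> 0" using k by (simp add: mult_le_0_iff)
        then show False using 1 \<eta> by simp
      next
        case False
        then have "k * (b' - b) \<le> k * (a' - a)" using A B by (auto split: if_splits)
        then have "b' - b \<le> a' - a" using k by simp
        then show False using wd(3) ud(3) False by auto
      qed
    qed
  qed
  have "exp (- l * t) * (u t x - w t x) \<le> 0"
  proof (rule field_le_epsilon)
    fix e :: real assume "e > 0"
    then show "exp (- l * t) * (u t x - w t x) \<le> 0 + e"
      using key[of "e / P x"] P34[of x] by auto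
  qed
  then show ?thesis by (simp add: mult_le_0_iff)
qed

lemma has_second_derivative_glue_left:
  assumes "has_second_derivative l D x" "x < c"
  shows "has_second_derivative (\<lambda>x. if x \<le> c then l x else r x) D x"
  using assms(1)
proof (rule has_second_derivative_transform)
  show "\<forall>\<^sub>F y in nhds x. l y = (if y \<le> c then l y else r y)"
    using eventually_nhds_in_open[of "{..<c}" x] assms(2) by (auto elim!: eventually_mono)
qed

lemma has_second_derivative_glue_right:
  assumes "has_second_derivative r D x" "c < x"
  shows "has_second_derivative (\<lambda>x. if x \<le> c then l x else r x) D x"
  using assms(1)
proof (rule has_second_derivative_transform)
  show "\<forall>\<^sub>F y in nhds x. r y = (if y \<le> c then l y else r y)"
    using eventually_nhds_in_open[of "{c<..}" x] assms(2) by (auto elim!: eventually_mono)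
qed

lemma has_derivative_glue_left:
  fixes l r :: "real \<Rightarrow> real"
  assumes "(l has_real_derivative a) (at c within {..c})"
  shows "((\<lambda>x. if x \<le> c then l x else r x) has_real_derivative a) (at c within {..c})"
  using assms by (rule has_field_derivative_transform_within[of _ _ _ _ 1]) auto

lemma has_derivative_glue_right:
  fixes l r :: "real \<Rightarrow> real"
  assumes "(r has_real_derivative b) (at c within {c..})" "l c = r c"
  shows "((\<lambda>x. if x \<le> c then l x else r x) has_real_derivative b) (at c within {c..})"
  using assms(1) by (rule has_field_derivative_transform_within[of _ _ _ _ 1]) (use assms(2) in auto)

lemma continuous_on_glue:
  fixes l r :: "'a::topological_space \<Rightarrow> real \<Rightarrow> real"
  assumes "continuous_on (S \<times> {..c}) (\<lambda>(t, x). l t x)" "continuous_on (S \<times> {c..}) (\<lambda>(t, x). r t x)"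
    "\<And>t. t \<in> S \<Longrightarrow> l t c = r t c"
  shows "continuous_on (S \<times> UNIV) (\<lambda>(t, x). if x \<le> c then l t x else r t x)"
proof -
  have S: "S \<times> {..c} \<union> S \<times> {c..} = S \<times> UNIV" by auto
  have "continuous_on (S \<times> {..c} \<union> S \<times> {c..})
      (\<lambda>p. if snd p \<le> c then (\<lambda>(t, x). l t x) p else (\<lambda>(t, x). r t x) p)"
  proof (rule continuous_on_cases_local)
    show "closedin (top_of_set (S \<times> {..c} \<union> S \<times> {c..})) (S \<times> {..c})"
      unfolding S by (intro closedin_Times) auto
    show "closedin (top_of_set (S \<times> {..c} \<union> S \<times> {c..})) (S \<times> {c..})"
      unfolding S by (intro closedin_Times) auto
  qed (use assms in auto)
  then show ?thesis unfolding S split_beta fst_conv snd_conv .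
qed

text \<open>
  The only form in which time-dependent barriers are used below: one smooth formula per patch, so that the
  interface is the only corner.
\<close>

lemma supersolution_glued_at_interface:
  assumes "continuous_on ({t0..t1} \<times> {..0}) (\<lambda>(t, x). l t x)"
    "continuous_on ({t0..t1} \<times> {0..}) (\<lambda>(t, x). r t x)"
    "\<And>t. t \<in> {t0..t1} \<Longrightarrow> l t 0 = r t 0"
    "\<And>t x. t \<in> {t0..t1} \<Longrightarrow> x \<le> 0 \<Longrightarrow> 0 \<le> l t x" "\<And>t x. t \<in> {t0..t1} \<Longrightarrow> 0 \<le> x \<Longrightarrow> 0 \<le> r t x"
    "\<And>t x. t \<in> {t0<..t1} \<Longrightarrow> x < 0 \<Longrightarrow> \<exists>D D2. ((\<lambda>s. l s x) has_real_derivative D) (at t) \<and>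
        has_second_derivative (l t) D2 x \<and> d1 * D2 + f1 (l t x) \<le> D"
    "\<And>t x. t \<in> {t0<..t1} \<Longrightarrow> 0 < x \<Longrightarrow> \<exists>D D2. ((\<lambda>s. r s x) has_real_derivative D) (at t) \<and>
        has_second_derivative (r t) D2 x \<and> d2 * D2 + f2 (r t x) \<le> D"
    "\<And>t. t \<in> {t0<..t1} \<Longrightarrow> \<exists>a b. (l t has_real_derivative a) (at 0) \<and>
        (r t has_real_derivative b) (at 0) \<and> \<sigma> * b \<le> a"
  shows "supersolution_on d1 d2 \<sigma> f1 f2 t0 t1 (\<lambda>t x. if x \<le> 0 then l t x else r t x)"
    (is "supersolution_on _ _ _ _ _ _ _ ?w")
  unfolding supersolution_on_def
proof (intro conjI ballI allI)
  show "continuous_on ({t0..t1} \<times> UNIV) (\<lambda>(t, x). ?w t x)"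
    using assms(1-3) by (rule continuous_on_glue)
next
  fix t x :: real assume "t \<in> {t0..t1}"
  then show "0 \<le> ?w t x" using assms(4,5) by simp
next
  fix t x :: real assume t: "t \<in> {t0<..t1}"
  consider "x < 0" | "x = 0" | "0 < x" by linarith
  then show "supersolution_at d1 d2 f1 f2 ?w t x \<or> concave_corner_at \<sigma> (?w t) x"
  proof cases
    case 1
    then obtain D D2 where "((\<lambda>s. l s x) has_real_derivative D) (at t)"
        "has_second_derivative (l t) D2 x" "d1 * D2 + f1 (l t x) \<le> D" using assms(6)[OF t] by blast
    then show ?thesis
      using 1 has_second_derivative_glue_left[of "l t" D2 x 0 "r t"] unfolding supersolution_at_def by auto
  next
    case 3
    then obtain D D2 where "((\<lambda>s. r s x) has_real_derivative D) (at t)"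
        "has_second_derivative (r t) D2 x" "d2 * D2 + f2 (r t x) \<le> D" using assms(7)[OF t] by blast
    then show ?thesis
      using 3 has_second_derivative_glue_right[of "r t" D2 x 0 "l t"] unfolding supersolution_at_def by auto
  next
    case 2
    obtain a b where ab: "(l t has_real_derivative a) (at 0)" "(r t has_real_derivative b) (at 0)" "\<sigma> * b \<le> a"
      using assms(8)[OF t] by blast
    have "(?w t has_real_derivative a) (at 0 within {..0})"
      by (rule has_derivative_glue_left[OF has_field_derivative_at_within[OF ab(1)]])
    moreover have "(?w t has_real_derivative b) (at 0 within {0..})"
      by (rule has_derivative_glue_right[OF has_field_derivative_at_within[OF ab(2)]])
        (use t assms(3) in simp)
    ultimately show ?thesis using ab(3) 2 unfolding concave_corner_at_def by auto
  qed
qed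

section \<open>Control of the solution over finite times\<close>

lemma sublinear_bound:
  fixes f :: "real \<Rightarrow> real"
  assumes "f C1_differentiable_on UNIV" "f 0 = 0" "\<And>s. K < s \<Longrightarrow> f s \<le> 0"
  obtains C where "C \<ge> 0" "\<And>s. 0 \<le> s \<Longrightarrow> f s \<le> C * s"
proof -
  obtain C where C: "C \<ge> 0" "\<And>x y. x \<in> {0..K} \<Longrightarrow> y \<in> {0..K} \<Longrightarrow> \<bar>f x - f y\<bar> \<le> C * \<bar>x - y\<bar>"
    using C1_Lipschitz_on_interval[OF assms(1)] by blast
  have "f s \<le> C * s" if "0 \<le> s" for s
  proof (cases "s \<le> K")
    case True
    then show ?thesis using C(2)[of s 0] that assms(2) by simp
  next
    case False
    then show ?thesis using assms(3)[of s] mult_nonneg_nonneg[OF C(1) that] by simp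
  qed
  then show thesis using that C(1) by blast
qed

lemma admissible_datum_bounds:
  assumes "admissible_datum u0"
  shows "\<exists>R>0. \<exists>M>0. (\<forall>x. u0 x \<le> M) \<and> (\<forall>x. R < \<bar>x\<bar> \<longrightarrow> u0 x = 0)"
proof -
  have K: "compact (closure {x. u0 x \<noteq> 0})" and c: "continuous_on UNIV u0"
    using assms unfolding admissible_datum_def by auto
  obtain R where R: "R > 0" "\<And>x. x \<in> closure {x. u0 x \<noteq> 0} \<Longrightarrow> norm x \<le> R"
    using compact_imp_bounded[OF K] unfolding bounded_pos by blast
  have "compact (u0 ` closure {x. u0 x \<noteq> 0})"
    using continuous_on_subset[OF c subset_UNIV] K by (rule compact_continuous_image)
  then obtain M where M: "M > 0" "\<And>x. x \<in> closure {x. u0 x \<noteq> 0} \<Longrightarrow> norm (u0 x) \<le> M"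
    by (auto dest!: compact_imp_bounded simp: bounded_pos)
  have sub: "x \<in> closure {x. u0 x \<noteq> 0}" if "u0 x \<noteq> 0" for x
    using closure_subset[of "{x. u0 x \<noteq> 0}"] that by blast
  have "u0 x \<le> M" for x using M sub[of x] by (cases "u0 x = 0") force+
  moreover have "u0 x = 0" if "R < \<bar>x\<bar>" for x using R(2)[OF sub[of x]] that by force
  ultimately show ?thesis using R(1) M(1) by blast
qed

text \<open>
  The reactions are at most linear, so \<open>exp (B t - x)\<close> in patch 2, continued by its trace in patch 1,
  is a supersolution for large \<open>B\<close>. Its speed is irrelevant over a bounded time interval.
\<close>

lemma finite_time_decay:
  assumes d: "0 < d1" "0 < d2" "0 < \<sigma>"
    and f: "f1 C1_differentiable_on UNIV" "f2 C1_differentiable_on UNIV"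
    and C: "0 \<le> C" "\<And>s. 0 \<le> s \<Longrightarrow> f1 s \<le> C * s" "\<And>s. 0 \<le> s \<Longrightarrow> f2 s \<le> C * s"
    and u0: "admissible_datum u0" and u: "solution_of_P d1 d2 \<sigma> f1 f2 u0 u"
  obtains A where "A > 0" "\<And>t x. t \<in> {0..T} \<Longrightarrow> 0 \<le> x \<Longrightarrow> u t x \<le> A * exp (- x)"
proof -
  obtain R M where MR: "R > 0" "M > 0" "\<And>x. u0 x \<le> M" "\<And>x. R < \<bar>x\<bar> \<Longrightarrow> u0 x = 0"
    using admissible_datum_bounds[OF u0] by blast
  define B where "B = d2 + C"
  define l where "l = (\<lambda>t (x::real). M * exp R * exp (B * t))"
  define r where "r = (\<lambda>t x. M * exp R * exp (B * t - x))"
  let ?w = "\<lambda>t x. if x \<le> 0 then l t x else r t x"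
  have "supersolution_on d1 d2 \<sigma> f1 f2 0 T ?w"
  proof (rule supersolution_glued_at_interface)
    show "continuous_on ({0..T} \<times> {..0}) (\<lambda>(t, x). l t x)" "continuous_on ({0..T} \<times> {0..}) (\<lambda>(t, x). r t x)"
      unfolding l_def r_def by (auto simp: split_beta intro!: continuous_intros)
    show "l t 0 = r t 0" for t by (simp add: l_def r_def)
    show "0 \<le> l t x" "0 \<le> r t x" for t x using MR by (simp_all add: l_def r_def)
  next
    fix t x :: real assume x: "x < 0"
    have "((\<lambda>s. l s x) has_real_derivative B * l t x) (at t)"
      unfolding l_def by (auto intro!: derivative_eq_intros)
    moreover have "has_second_derivative (l t) 0 x"
      by (rule has_second_derivativeI[of UNIV _ "\<lambda>x. 0"]) (auto simp: l_def)
    moreover have "d1 * 0 + f1 (l t x) \<le> B * l t x"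
    proof -
      have "0 \<le> l t x" using MR by (simp add: l_def)
      then have "f1 (l t x) \<le> C * l t x" "0 \<le> d2 * l t x" using C d by auto
      then show ?thesis by (simp add: B_def algebra_simps)
    qed
    ultimately show "\<exists>D D2. ((\<lambda>s. l s x) has_real_derivative D) (at t) \<and>
        has_second_derivative (l t) D2 x \<and> d1 * D2 + f1 (l t x) \<le> D" by blast
  next
    fix t x :: real assume x: "0 < x"
    have "((\<lambda>s. r s x) has_real_derivative B * r t x) (at t)"
      unfolding r_def by (auto intro!: derivative_eq_intros)
    moreover have "has_second_derivative (r t) (r t x) x"
      by (rule has_second_derivativeI[of UNIV _ "\<lambda>x. - r t x"]) (auto simp: r_def intro!: derivative_eq_intros)
    moreover have "d2 * r t x + f2 (r t x) \<le> B * r t x"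
    proof -
      have "0 \<le> r t x" using MR by (simp add: r_def)
      then have "f2 (r t x) \<le> C * r t x" using C by auto
      then show ?thesis by (simp add: B_def algebra_simps)
    qed
    ultimately show "\<exists>D D2. ((\<lambda>s. r s x) has_real_derivative D) (at t) \<and>
        has_second_derivative (r t) D2 x \<and> d2 * D2 + f2 (r t x) \<le> D" by blast
  next
    fix t :: real
    have "(l t has_real_derivative 0) (at 0)" by (simp add: l_def)
    moreover have "(r t has_real_derivative - r t 0) (at 0)"
      unfolding r_def by (auto intro!: derivative_eq_intros)
    moreover have "\<sigma> * (- r t 0) \<le> 0" using MR d by (simp add: r_def)
    ultimately show "\<exists>a b. (l t has_real_derivative a) (at 0) \<and>
        (r t has_real_derivative b) (at 0) \<and> \<sigma> * b \<le> a" by blast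
  qed
  note super = this
  have init: "u 0 x \<le> ?w 0 x" for x
  proof -
    have ux: "u 0 x = u0 x" using u unfolding solution_of_P_def classical_solution_def by blast
    show ?thesis
    proof (cases "R < \<bar>x\<bar>")
      case True
      then show ?thesis using ux MR by (auto simp: l_def r_def)
    next
      case False
      have "M * 1 \<le> M * exp R" "M * 1 \<le> M * exp (R - x)"
        using MR False by (intro mult_left_mono; auto)+
      moreover have "exp R * exp (- x) = exp (R - x)" by (simp add: exp_diff exp_minus field_simps)
      ultimately show ?thesis using ux MR(3)[of x] by (auto simp: l_def r_def mult.assoc)
    qed
  qed
  have uw: "u t x \<le> ?w t x" if "t \<in> {0..T}" for t x
    using comparison_principle[OF d f u super order_refl init that] .
  have B: "B \<ge> 0" using C d by (simp add: B_def)
  have "u t x \<le> (M * exp R * exp (B * T)) * exp (- x)" if "t \<in> {0..T}" "0 \<le> x" for t x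
  proof -
    have "?w t x = (M * exp R * exp (B * t)) * exp (- x)"
      using that by (auto simp: l_def r_def exp_diff exp_minus field_simps)
    also have "\<dots> \<le> (M * exp R * exp (B * T)) * exp (- x)"
      using that MR B by (intro mult_right_mono mult_left_mono) (auto intro: mult_left_mono)
    finally show ?thesis using uw[OF that(1), of x] by linarith
  qed
  then show thesis using that[of "M * exp R * exp (B * T)"] MR by simp
qed

text \<open>
  The finite-time decay reduces blocking to an estimate that may start arbitrarily late, where the
  starting time depends on the desired smallness.
\<close>

lemma blocked_in_patch_2I:
  assumes d: "0 < d1" "0 < d2" "0 < \<sigma>"
    and f: "f1 C1_differentiable_on UNIV" "f2 C1_differentiable_on UNIV"
    and C: "0 \<le> C" "\<And>s. 0 \<le> s \<Longrightarrow> f1 s \<le> C * s" "\<And>s. 0 \<le> s \<Longrightarrow> f2 s \<le> C * s"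
    and u0: "admissible_datum u0" and u: "solution_of_P d1 d2 \<sigma> f1 f2 u0 u"
    and late: "\<And>e. e > 0 \<Longrightarrow> \<exists>T R. \<forall>t\<ge>T. \<forall>x\<ge>R. u t x \<le> e"
  shows "blocked_in_patch_2 u"
  unfolding blocked_in_patch_2_def uniform_limit_iff
proof (intro allI impI)
  fix e :: real assume e: "e > 0"
  obtain T R where TR: "\<And>t x. t \<ge> T \<Longrightarrow> x \<ge> R \<Longrightarrow> u t x \<le> e / 2"
    using late[of "e/2"] e by auto
  obtain A where A: "A > 0" "\<And>t x. t \<in> {0..T} \<Longrightarrow> 0 \<le> x \<Longrightarrow> u t x \<le> A * exp (- x)"
    using finite_time_decay[OF d f C u0 u, of T] by blast
  have "((\<lambda>x. A * exp (- x)) \<longlongrightarrow> A * 0) at_top"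
    by (intro tendsto_mult tendsto_const filterlim_compose[OF exp_at_bot] filterlim_uminus_at_bot_at_top)
  then have "\<forall>\<^sub>F x in at_top. A * exp (- x) < e"
    using e by (auto dest: order_tendstoD(2))
  then show "\<forall>\<^sub>F x in at_top. \<forall>t\<in>{0..}. dist (u t x) 0 < e"
    using eventually_ge_at_top[of "max R 0"]
  proof eventually_elim
    case (elim x)
    show ?case
    proof
      fix t :: real assume t: "t \<in> {0..}"
      have "0 \<le> u t x" using u t unfolding solution_of_P_def by auto
      moreover have "u t x < e"
      proof (cases "T \<le> t")
        case True
        then show ?thesis using TR[of t x] elim e by auto
      next
        case False
        then show ?thesis using A(2)[of t x] elim t by auto
      qed
      ultimately show "dist (u t x) 0 < e" by simp
    qed
  qed
qed

text \<open>
  Where both reactions are negative, a spatially constant barrier can be lowered at constant speed,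
  and it arrives at \<open>N\<close> in finite time.
\<close>

lemma eventually_below:
  assumes d: "0 < d1" "0 < d2" "0 < \<sigma>"
    and f: "f1 C1_differentiable_on UNIV" "f2 C1_differentiable_on UNIV"
    and N: "0 < N" "\<And>s. N \<le> s \<Longrightarrow> f1 s < 0" "\<And>s. N \<le> s \<Longrightarrow> f2 s < 0"
    and u: "solution_of_P d1 d2 \<sigma> f1 f2 u0 u"
  obtains T where "T \<ge> 0" "\<And>x. u T x \<le> N"
proof -
  obtain M0 where M0: "\<And>t x. t \<ge> 0 \<Longrightarrow> u t x \<le> M0" using u unfolding solution_of_P_def by blast
  define M where "M = max M0 N"
  have "continuous_on {N..M} (\<lambda>s. max (f1 s) (f2 s))"
    using f by (intro continuous_intros C1_differentiable_imp_continuous_on)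
      (auto elim: C1_differentiable_on_subset)
  moreover have "{N..M} \<noteq> {}" by (simp add: M_def)
  ultimately obtain p where p: "p \<in> {N..M}" "\<And>s. s \<in> {N..M} \<Longrightarrow> max (f1 s) (f2 s) \<le> max (f1 p) (f2 p)"
    using continuous_attains_sup[of "{N..M}" "\<lambda>s. max (f1 s) (f2 s)"] by auto
  define \<delta> where "\<delta> = - max (f1 p) (f2 p)"
  have \<delta>: "\<delta> > 0" using p(1) N(2,3)[of p] by (auto simp: \<delta>_def)
  define T where "T = (M - N) / \<delta>"
  have T: "T \<ge> 0" using \<delta> by (simp add: T_def M_def)
  define w where "w = (\<lambda>t (x::real). M - \<delta> * t)"
  have w: "w t x \<in> {N..M}" if "t \<in> {0..T}" for t x
  proof -
    have "\<delta> * t \<le> \<delta> * T" "0 \<le> \<delta> * t" using that \<delta> by auto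
    moreover have "\<delta> * T = M - N" using \<delta> by (simp add: T_def)
    ultimately show ?thesis by (simp add: w_def)
  qed
  have dw: "((\<lambda>s. w s x) has_real_derivative - \<delta>) (at t)" "has_second_derivative (w t) 0 x"
    "(w t has_real_derivative 0) (at x)" for t x
    by (auto simp: w_def intro!: derivative_eq_intros has_second_derivativeI[of UNIV _ "\<lambda>x. 0"])
  have "supersolution_on d1 d2 \<sigma> f1 f2 0 T (\<lambda>t x. if x \<le> 0 then w t x else w t x)"
  proof (rule supersolution_glued_at_interface)
    show "continuous_on ({0..T} \<times> {..0}) (\<lambda>(t, x). w t x)" "continuous_on ({0..T} \<times> {0..}) (\<lambda>(t, x). w t x)"
      unfolding w_def by (auto simp: split_beta intro!: continuous_intros)
    show "0 \<le> w t x" "0 \<le> w t x" if "t \<in> {0..T}" for t x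
      using w[OF that, of x] N(1) by simp_all
  next
    fix t x :: real assume "t \<in> {0<..T}"
    then have "max (f1 (w t x)) (f2 (w t x)) \<le> - \<delta>" using p(2)[OF w] by (simp add: \<delta>_def)
    then have "d1 * 0 + f1 (w t x) \<le> - \<delta>" "d2 * 0 + f2 (w t x) \<le> - \<delta>" by simp_all
    then show "\<exists>D D2. ((\<lambda>s. w s x) has_real_derivative D) (at t) \<and>
        has_second_derivative (w t) D2 x \<and> d1 * D2 + f1 (w t x) \<le> D"
      and "\<exists>D D2. ((\<lambda>s. w s x) has_real_derivative D) (at t) \<and>
        has_second_derivative (w t) D2 x \<and> d2 * D2 + f2 (w t x) \<le> D"
      using dw(1)[of x t] dw(2)[of t x] by blast+
  next
    fix t :: real
    show "\<exists>a b. (w t has_real_derivative a) (at 0) \<and> (w t has_real_derivative b) (at 0) \<and> \<sigma> * b \<le> a"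
      using dw(3)[of t 0] by (intro exI[of _ 0]) simp
  qed simp
  then have "supersolution_on d1 d2 \<sigma> f1 f2 0 T w" by simp
  moreover have "u 0 x \<le> w 0 x" for x using M0[of 0 x] by (simp add: w_def M_def)
  ultimately have "u T x \<le> w T x" for x
    using comparison_principle[OF d f u] T by fastforce
  moreover have "w T x = N" for x using \<delta> by (simp add: w_def T_def)
  ultimately show thesis using that T by metis
qed

section \<open>Decreasing profiles of zero energy\<close>

text \<open>
  The equation \<open>\<phi>' = - g(\<phi>)\<close> is separable: \<open>\<phi>\<close> is the inverse of an antiderivative \<open>X\<close> of \<open>- 1/g\<close>.
  The linear bounds on \<open>g\<close> at the zeros 0 and \<open>a\<close> make \<open>X\<close> diverge logarithmically at both ends,
  so \<open>X\<close> maps \<open>(0, a)\<close> onto the whole line and \<open>\<phi>\<close> is global.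
\<close>

lemma decreasing_profile_exists:
  fixes g :: "real \<Rightarrow> real"
  assumes a: "0 < a" and C: "0 < C" and g: "continuous_on {0<..<a} g" "\<And>s. s \<in> {0<..<a} \<Longrightarrow> 0 < g s"
    "\<And>s. s \<in> {0<..<a} \<Longrightarrow> g s \<le> C * s" "\<And>s. s \<in> {0<..<a} \<Longrightarrow> g s \<le> C * (a - s)"
  shows "\<exists>\<phi>. (\<forall>x. \<phi> x \<in> {0<..<a}) \<and> (\<forall>x. (\<phi> has_real_derivative - g (\<phi> x)) (at x)) \<and>
     (\<phi> \<longlongrightarrow> 0) at_top \<and> (\<phi> \<longlongrightarrow> a) at_bot \<and> antimono \<phi>"
proof -
  have gc: "isCont (\<lambda>s. - inverse (g s)) s" if "s \<in> {0<..<a}" for s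
    using g(1) g(2)[OF that] that
    by (intro continuous_intros) (auto simp: continuous_on_eq_continuous_at)
  obtain X where X: "\<And>s. s \<in> {0<..<a} \<Longrightarrow> (X has_real_derivative - inverse (g s)) (at s)"
    using einterval_antiderivative[of "ereal 0" "ereal a" "\<lambda>s. - inverse (g s)"] a gc
    by (auto simp: has_real_derivative_iff_has_vector_derivative)
  have Xdec: "X t < X s" if "0 < s" "s < t" "t < a" for s t
  proof (rule DERIV_neg_imp_decreasing[OF that(2)])
    fix x assume "s \<le> x" "x \<le> t"
    then have "x \<in> {0<..<a}" using that by simp
    then show "\<exists>y. (X has_real_derivative y) (at x) \<and> y < 0"
      using X[of x] g(2)[of x] by (intro exI[of _ "- inverse (g x)"]) simp
  qed
  have Xcont: "isCont X s" if "s \<in> {0<..<a}" for s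
    using X[OF that] by (rule DERIV_isCont)
  have low: "X (a/2) + ln (a/2) / C - ln s / C \<le> X s" if "0 < s" "s \<le> a / 2" for s
  proof -
    have "X (a/2) + ln (a/2) / C \<le> X s + ln s / C"
    proof (rule DERIV_nonpos_imp_nonincreasing[OF that(2), of "\<lambda>s. X s + ln s / C"])
      fix x assume "s \<le> x" "x \<le> a / 2"
      then have x: "x \<in> {0<..<a}" using that a by simp
      have "((\<lambda>s. X s + ln s / C) has_real_derivative - inverse (g x) + inverse (C * x)) (at x)"
        using X[OF x] x C by (auto intro!: derivative_eq_intros simp: field_simps)
      moreover have "inverse (C * x) \<le> inverse (g x)"
        using g(2,3)[OF x] by (intro le_imp_inverse_le)
      ultimately show "\<exists>y. ((\<lambda>s. X s + ln s / C) has_real_derivative y) (at x) \<and> y \<le> 0"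
        by (intro exI[of _ "- inverse (g x) + inverse (C * x)"]) simp
    qed
    then show ?thesis by simp
  qed
  have high: "X s \<le> X (a/2) - ln (a/2) / C + ln (a - s) / C" if "a / 2 \<le> s" "s < a" for s
  proof -
    have "X s - ln (a - s) / C \<le> X (a/2) - ln (a - a/2) / C"
    proof (rule DERIV_nonpos_imp_nonincreasing[OF that(1), of "\<lambda>s. X s - ln (a - s) / C"])
      fix x assume "a / 2 \<le> x" "x \<le> s"
      then have x: "x \<in> {0<..<a}" using that a by simp
      have "((\<lambda>s. X s - ln (a - s) / C) has_real_derivative - inverse (g x) + inverse (C * (a - x))) (at x)"
        using X[OF x] x C by (auto intro!: derivative_eq_intros simp: field_simps)
      moreover have "inverse (C * (a - x)) \<le> inverse (g x)"
        using g(2,4)[OF x] by (intro le_imp_inverse_le)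
      ultimately show "\<exists>y. ((\<lambda>s. X s - ln (a - s) / C) has_real_derivative y) (at x) \<and> y \<le> 0"
        by (intro exI[of _ "- inverse (g x) + inverse (C * (a - x))"]) simp
    qed
    then show ?thesis by simp
  qed
  have ex: "\<exists>s\<in>{0<..<a}. X s = x" for x
  proof -
    define p where "p = min (a/2) (exp ((X (a/2) + ln (a/2) / C - x) * C))"
    have p: "0 < p" "p \<le> a/2" using a by (auto simp: p_def)
    have "ln p \<le> ln (exp ((X (a/2) + ln (a/2) / C - x) * C))"
      using p(1) by (intro ln_mono) (auto simp: p_def)
    then have "ln p / C \<le> X (a/2) + ln (a/2) / C - x"
      unfolding ln_exp by (simp only: pos_divide_le_eq[OF C])
    then have 1: "x \<le> X p" using low[OF p] by simp
    define q where "q = a - min (a/2) (exp ((x - X (a/2) + ln (a/2) / C) * C))"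
    have q: "a/2 \<le> q" "q < a" using a by (auto simp: q_def)
    have "ln (a - q) \<le> ln (exp ((x - X (a/2) + ln (a/2) / C) * C))"
      using q(2) by (intro ln_mono) (auto simp: q_def)
    then have "ln (a - q) / C \<le> x - X (a/2) + ln (a/2) / C"
      unfolding ln_exp by (simp only: pos_divide_le_eq[OF C])
    then have 2: "X q \<le> x" using high[OF q] by simp
    have "\<exists>s\<ge>p. s \<le> q \<and> X s = x"
      by (rule IVT2) (use 1 2 p q Xcont a in auto)
    then show ?thesis using p q by force
  qed
  define \<phi> where "\<phi> = (\<lambda>x. SOME s. s \<in> {0<..<a} \<and> X s = x)"
  have \<phi>: "\<phi> x \<in> {0<..<a}" "X (\<phi> x) = x" for x
    using someI_ex[of "\<lambda>s. s \<in> {0<..<a} \<and> X s = x"] ex[of x] unfolding \<phi>_def by blast+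
  have \<phi>X: "\<phi> (X s) = s" if "s \<in> {0<..<a}" for s
    using Xdec[of s "\<phi> (X s)"] Xdec[of "\<phi> (X s)" s] \<phi>[of "X s"] that
    by (cases s "\<phi> (X s)" rule: linorder_cases) auto
  have less: "\<phi> x < s" if "X s < x" "s \<in> {0<..<a}" for x s
    using Xdec[of s "\<phi> x"] \<phi>[of x] that by (cases s "\<phi> x" rule: linorder_cases) auto
  have greater: "s < \<phi> x" if "x < X s" "s \<in> {0<..<a}" for x s
    using Xdec[of "\<phi> x" s] \<phi>[of x] that by (cases s "\<phi> x" rule: linorder_cases) auto
  have "isCont \<phi> x" for x
  proof -
    define e where "e = min (\<phi> x) (a - \<phi> x) / 2"
    have e: "0 < e" using \<phi>(1)[of x] by (simp add: e_def)
    have "2 * e \<le> \<phi> x" "2 * e \<le> a - \<phi> x" by (simp_all add: e_def)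
    then have in_a: "z \<in> {0<..<a}" if "\<bar>z - \<phi> x\<bar> \<le> e" for z
      using that e unfolding abs_le_iff greaterThanLessThan_iff by linarith
    have "isCont \<phi> (X (\<phi> x))"
      by (rule isCont_inverse_function[OF e]) (use in_a \<phi>X Xcont in auto)
    then show ?thesis using \<phi>(2) by simp
  qed
  then have d\<phi>: "(\<phi> has_real_derivative - g (\<phi> x)) (at x)" for x
    using DERIV_inverse_function[of X "- inverse (g (\<phi> x))" \<phi> x "x - 1" "x + 1"]
      X[OF \<phi>(1)[of x]] \<phi>(2) g(2)[OF \<phi>(1)[of x]] by simp
  have "antimono \<phi>"
  proof (rule antimonoI)
    fix x y :: real assume "x \<le> y"
    then show "\<phi> y \<le> \<phi> x" using greater[of x "\<phi> y"] \<phi>[of y] by (cases "x = y") auto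
  qed
  moreover have "(\<phi> \<longlongrightarrow> 0) at_top"
  proof (rule order_tendstoI)
    fix e :: real assume "0 < e"
    define s where "s = min e a / 2"
    have s: "s \<in> {0<..<a}" "s < e" using \<open>0 < e\<close> a by (auto simp: s_def min_def)
    show "\<forall>\<^sub>F x in at_top. \<phi> x < e"
      using eventually_gt_at_top[of "X s"] by eventually_elim (use less[OF _ s(1)] s(2) in force)
  next
    fix e :: real assume "e < 0"
    then show "\<forall>\<^sub>F x in at_top. e < \<phi> x" using \<phi>(1) by (auto intro!: always_eventually intro: less_trans)
  qed
  moreover have "(\<phi> \<longlongrightarrow> a) at_bot"
  proof (rule order_tendstoI)
    fix e :: real assume "e < a"
    define s where "s = (max e 0 + a) / 2"
    have s: "s \<in> {0<..<a}" "e < s" using \<open>e < a\<close> a by (auto simp: s_def max_def)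
    show "\<forall>\<^sub>F x in at_bot. e < \<phi> x"
      using eventually_gt_at_bot[of "X s"] by eventually_elim (use greater[OF _ s(1)] s(2) in force)
  next
    fix e :: real assume "a < e"
    then show "\<forall>\<^sub>F x in at_bot. \<phi> x < e" using \<phi>(1) by (auto intro!: always_eventually intro: less_trans)
  qed
  ultimately show ?thesis using \<phi>(1) d\<phi> by blast
qed

text \<open>
  Differentiating \<open>d \<phi>'\<^sup>2 / 2 + F(\<phi>) = 0\<close> gives \<open>d \<phi>'' + f(\<phi>) = 0\<close>. The formula for \<open>g\<close> is
  needed only on a range \<open>(0, b)\<close> containing the value of \<open>\<phi>\<close> at the point considered, which leaves \<open>g\<close> free to be
  modified outside that range.
\<close>

lemma second_derivative_of_energy_profile:
  assumes F: "\<And>s. (F has_real_derivative f s) (at s)" and d: "0 < d"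
    and \<phi>: "\<And>x. (\<phi> has_real_derivative - g (\<phi> x)) (at x)"
    and b: "\<And>s. s \<in> {0<..<b} \<Longrightarrow> F s < 0 \<and> g s = sqrt (- 2 * F s / d)" "\<phi> x \<in> {0<..<b}"
  shows "has_second_derivative \<phi> (- f (\<phi> x) / d) x"
proof (rule has_second_derivativeI[of UNIV _ "\<lambda>y. - g (\<phi> y)"])
  define c where "c = sqrt (- 2 * F (\<phi> x) / d)"
  have Fx: "F (\<phi> x) < 0" using b by blast
  have c: "c > 0" "c = g (\<phi> x)" using b Fx d by (auto simp: c_def field_simps)
  have "((\<lambda>s. sqrt (- 2 * F s / d)) has_real_derivative - (f (\<phi> x) / d) / c) (at (\<phi> x))"
    using Fx d by (auto intro!: derivative_eq_intros F simp: c_def field_simps)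
  then have "(g has_real_derivative - (f (\<phi> x) / d) / c) (at (\<phi> x))"
    by (rule has_field_derivative_transform_within_open[of _ _ _ "{0<..<b}"]) (use b in auto)
  then have "((\<lambda>y. g (\<phi> y)) has_real_derivative (- (f (\<phi> x) / d) / c) * (- g (\<phi> x))) (at x)"
    using \<phi> by (rule DERIV_chain2)
  then show "((\<lambda>y. - g (\<phi> y)) has_real_derivative - f (\<phi> x) / d) (at x)"
    using c by (auto intro!: derivative_eq_intros simp: field_simps)
qed (use \<phi> in auto)

lemma antiderivative_exists:
  fixes f :: "real \<Rightarrow> real"
  assumes "continuous_on UNIV f"
  obtains F where "\<And>s. (F has_real_derivative f s) (at s)" "F 0 = 0"
    "\<And>K. 0 \<le> K \<Longrightarrow> F K = integral {0..K} f"
proof -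
  obtain G where G: "\<And>s. (G has_real_derivative f s) (at s)"
    using einterval_antiderivative[of "-\<infinity>" "\<infinity>" f] assms
    by (auto simp: has_real_derivative_iff_has_vector_derivative continuous_on_eq_continuous_at)
  have "(f has_integral G K - G 0) {0..K}" if "0 \<le> K" for K
    by (rule fundamental_theorem_of_calculus[OF that])
      (use G in \<open>auto simp: has_real_derivative_iff_has_vector_derivative intro: has_vector_derivative_at_within\<close>)
  then have "\<And>K. 0 \<le> K \<Longrightarrow> G K - G 0 = integral {0..K} f" by (metis integral_unique)
  moreover have "((\<lambda>s. G s - G 0) has_real_derivative f s) (at s)" for s
    using DERIV_diff[OF G DERIV_const] by simp
  ultimately show thesis using that[of "\<lambda>s. G s - G 0"] by simp
qed

text \<open>
  A linear bound on \<open>f\<close> integrates to a quadratic bound on \<open>F\<close>, hence to a linear bound on the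
  slope \<open>sqrt (- 2 F / d)\<close>. The next lemma does the same from the upper equilibrium.
\<close>

lemma energy_bounds:
  assumes F: "\<And>s. (F has_real_derivative f s) (at s)" "F 0 = 0"
    and s: "0 \<le> s" and neg: "\<And>r. 0 \<le> r \<Longrightarrow> r \<le> s \<Longrightarrow> - (C * r) \<le> f r"
  shows "- (C * s\<^sup>2 / 2) \<le> F s"
proof -
  have "F 0 + C * 0\<^sup>2 / 2 \<le> F s + C * s\<^sup>2 / 2"
  proof (rule DERIV_nonneg_imp_nondecreasing[OF s, of "\<lambda>s. F s + C * s\<^sup>2 / 2"])
    fix r assume r: "0 \<le> r" "r \<le> s"
    have "((\<lambda>s. F s + C * s\<^sup>2 / 2) has_real_derivative f r + C * r) (at r)"
      by (auto intro!: derivative_eq_intros F)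
    then show "\<exists>y. ((\<lambda>s. F s + C * s\<^sup>2 / 2) has_real_derivative y) (at r) \<and> 0 \<le> y"
      using neg[OF r] by (intro exI[of _ "f r + C * r"]) simp
  qed
  then show ?thesis using F(2) by simp
qed

lemma energy_bounds_top:
  assumes F: "\<And>s. (F has_real_derivative f s) (at s)" "F K = 0"
    and s: "s \<le> K" and neg: "\<And>r. s \<le> r \<Longrightarrow> r \<le> K \<Longrightarrow> f r \<le> C * (K - r)"
  shows "- (C * (K - s)\<^sup>2 / 2) \<le> F s"
proof -
  have "F K + C * (K - K)\<^sup>2 / 2 \<le> F s + C * (K - s)\<^sup>2 / 2"
  proof (rule DERIV_nonpos_imp_nonincreasing[OF s, of "\<lambda>s. F s + C * (K - s)\<^sup>2 / 2"])
    fix r assume r: "s \<le> r" "r \<le> K"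
    have "((\<lambda>s. F s + C * (K - s)\<^sup>2 / 2) has_real_derivative f r - C * (K - r)) (at r)"
      by (auto intro!: derivative_eq_intros F simp: field_simps)
    then show "\<exists>y. ((\<lambda>s. F s + C * (K - s)\<^sup>2 / 2) has_real_derivative y) (at r) \<and> y \<le> 0"
      using neg[OF r] by (intro exI[of _ "f r - C * (K - r)"]) simp
  qed
  then show ?thesis using F(2) by simp
qed

text \<open>
  \<open>F\<close> decreases from 0 up to \<open>\<theta>\<close> and then increases to a value that is at most 0.
\<close>

lemma bistable_energy_negative:
  assumes F: "\<And>s. (F has_real_derivative f s) (at s)" "F 0 = 0"
    and \<theta>: "0 < \<theta>" "\<theta> < K" and FK: "F K \<le> 0"
    and f: "\<And>s. 0 < s \<Longrightarrow> s < \<theta> \<Longrightarrow> f s < 0" "\<And>s. \<theta> < s \<Longrightarrow> s < K \<Longrightarrow> 0 < f s"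
    and s: "0 < s" "s < K"
  shows "F s < 0"
proof -
  have cont: "continuous_on S F" for S
    using F(1) by (meson DERIV_isCont continuous_at_imp_continuous_on)
  show ?thesis
  proof (cases "s \<le> \<theta>")
    case True
    have "F s < F 0"
      by (rule DERIV_neg_imp_decreasing_open[OF s(1)]) (use F f True cont in force)+
    then show ?thesis using F(2) by simp
  next
    case False
    have "F s < F K"
      by (rule DERIV_pos_imp_increasing_open[OF s(2)]) (use F f False cont in force)+
    then show ?thesis using FK by simp
  qed
qed

section \<open>Barriers below negative energy\<close>

lemma has_second_derivative_add_const:
  assumes "has_second_derivative f D x"
  shows "has_second_derivative (\<lambda>x. f x + c) D x"
proof -
  have "has_second_derivative (\<lambda>x. - c) 0 x"
    by (rule has_second_derivativeI[of UNIV _ "\<lambda>x. 0"]) auto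
  from has_second_derivative_diff[OF assms this] show ?thesis by simp
qed

lemma energy_slope_bound:
  assumes "- (C * s\<^sup>2 / 2) \<le> F" "0 < d" "0 \<le> s"
  shows "sqrt (- 2 * F / d) \<le> sqrt (C / d) * s"
proof -
  have "- 2 * F / d \<le> C / d * s\<^sup>2" using assms by (simp add: field_simps)
  then have "sqrt (- 2 * F / d) \<le> sqrt (C / d * s\<^sup>2)" by (rule real_sqrt_le_mono)
  also have "\<dots> = sqrt (C / d) * s" unfolding real_sqrt_mult using assms(3) by simp
  finally show ?thesis .
qed

text \<open>
  The barrier is \<open>M\<close> up to a point \<open>R\<close> to the right of the support of \<open>u\<^sub>0\<close>, and the zero-energy
  profile starting at \<open>M\<close> beyond it. Since \<open>F(M) < 0\<close>, the profile leaves \<open>M\<close> with negative slope,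
  so the corner at \<open>R\<close> is concave.
\<close>

lemma blocked_below_negative_energy:
  assumes d: "0 < d1" "0 < d2" "0 < \<sigma>"
    and f: "f1 C1_differentiable_on UNIV" "f2 C1_differentiable_on UNIV"
    and C: "0 \<le> C" "\<And>s. 0 \<le> s \<Longrightarrow> f1 s \<le> C * s" "\<And>s. 0 \<le> s \<Longrightarrow> f2 s \<le> C * s"
    and u0: "admissible_datum u0" and u: "solution_of_P d1 d2 \<sigma> f1 f2 u0 u"
    and F: "\<And>s. (F has_real_derivative f2 s) (at s)" "F 0 = 0" and f20: "f2 0 = 0"
    and M: "0 < M" "f1 M \<le> 0" "f2 M \<le> 0" "\<And>s. 0 < s \<Longrightarrow> s \<le> M \<Longrightarrow> F s < 0"
    and u0M: "\<And>x. u0 x \<le> M"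
  shows "blocked_in_patch_2 u"
proof -
  obtain L where L: "L \<ge> 0" "\<And>x y. x \<in> {0..M} \<Longrightarrow> y \<in> {0..M} \<Longrightarrow> \<bar>f2 x - f2 y\<bar> \<le> L * \<bar>x - y\<bar>"
    using C1_Lipschitz_on_interval[OF f(2)] by blast
  define c where "c = sqrt (L / d2)"
  have c: "c \<ge> 0" using L d by (simp add: c_def)
  define h where "h = (\<lambda>s. sqrt (- 2 * F s / d2))"
  have hle: "h s \<le> c * s" if "0 \<le> s" "s \<le> M" for s
    unfolding h_def c_def
  proof (rule energy_slope_bound[OF energy_bounds[OF F that(1)] d(2) that(1)])
    fix r assume "0 \<le> r" "r \<le> s"
    then show "- (L * r) \<le> f2 r" using L(2)[of r 0] that f20 by (simp add: abs_le_iff)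
  qed
  have hpos: "h s > 0" if "0 < s" "s \<le> M" for s
    using M(4)[OF that] d by (simp add: h_def field_simps)
  define a where "a = M + 1"
  \<comment> \<open>Above \<open>M\<close> the slope law is replaced by a linear one vanishing at \<open>a\<close>, so that the profile is
    defined on the whole line; only its part below \<open>M\<close> enters the barrier.\<close>
  define g where "g = (\<lambda>s. if s \<le> M then h s else h M * (a - s))"
  have hM: "0 < h M" "h M \<le> c * M" using hpos hle M(1) by auto
  have "\<exists>\<phi>. (\<forall>x. \<phi> x \<in> {0<..<a}) \<and> (\<forall>x. (\<phi> has_real_derivative - g (\<phi> x)) (at x)) \<and>
     (\<phi> \<longlongrightarrow> 0) at_top \<and> (\<phi> \<longlongrightarrow> a) at_bot \<and> antimono \<phi>"
  proof (rule decreasing_profile_exists)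
    show "0 < a" using M by (simp add: a_def)
    show "0 < c * (M + 1) + 1" using mult_nonneg_nonneg[OF c, of "M + 1"] M(1) by linarith
    have "continuous_on UNIV F" using F(1) by (meson DERIV_isCont continuous_at_imp_continuous_on)
    then have "continuous_on S h" for S
      unfolding h_def using d by (intro continuous_intros) (auto intro: continuous_on_subset)
    then show "continuous_on {0<..<a} g"
      unfolding g_def
      by (intro continuous_on_cases_le[where h = "\<lambda>s. s"] continuous_intros) (auto simp: a_def)
    fix s assume s: "s \<in> {0<..<a}"
    show "0 < g s" using s hpos[of s] hM by (auto simp: g_def)
    show "g s \<le> (c * (M + 1) + 1) * s"
    proof (cases "s \<le> M")
      case True
      then have "g s \<le> c * s" using hle s by (simp add: g_def)
      also have "\<dots> \<le> (c * (M + 1) + 1) * s"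
        using s c M(1) by (intro mult_right_mono) (auto simp: algebra_simps)
      finally show ?thesis .
    next
      case False
      have "h M * (a - s) \<le> h M * 1" using hM False by (intro mult_left_mono) (auto simp: a_def)
      also have "\<dots> \<le> c * s" using hM(2) mult_left_mono[of M s c] c False by simp
      also have "\<dots> \<le> (c * (M + 1) + 1) * s"
        using s c M(1) by (intro mult_right_mono) (auto simp: algebra_simps)
      finally show ?thesis using False by (simp add: g_def)
    qed
    show "g s \<le> (c * (M + 1) + 1) * (a - s)"
    proof (cases "s \<le> M")
      case True
      then have "g s \<le> c * s" using hle s by (simp add: g_def)
      also have "\<dots> \<le> (c * (M + 1) + 1) * 1"
        using mult_left_mono[OF True c] c by (simp add: algebra_simps)
      also have "\<dots> \<le> (c * (M + 1) + 1) * (a - s)"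
        using c M(1) True by (intro mult_left_mono) (auto simp: a_def)
      finally show ?thesis .
    next
      case False
      have "h M \<le> c * (M + 1) + 1" using hM(2) c by (simp add: algebra_simps)
      then have "h M * (a - s) \<le> (c * (M + 1) + 1) * (a - s)"
        using s by (intro mult_right_mono) auto
      then show ?thesis using False by (simp add: g_def)
    qed
  qed
  then obtain \<phi> where \<phi>: "\<And>x. \<phi> x \<in> {0<..<a}" "\<And>x. (\<phi> has_real_derivative - g (\<phi> x)) (at x)"
    "(\<phi> \<longlongrightarrow> 0) at_top" "(\<phi> \<longlongrightarrow> a) at_bot" by blast
  have gpos: "0 < g s" if "s \<in> {0<..<a}" for s using that hpos[of s] hM by (auto simp: g_def)
  have \<phi>dec: "\<phi> y < \<phi> x" if "x < y" for x y
    by (rule DERIV_neg_imp_decreasing[OF that]) (use \<phi>(2) gpos[OF \<phi>(1)] in force)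
  obtain x0 where x0: "\<phi> x0 = M"
  proof -
    obtain p where p: "M < \<phi> p"
      using order_tendstoD(1)[OF \<phi>(4), of M] by (auto simp: a_def eventually_at_bot_linorder)
    obtain q where q: "\<phi> q < M"
      using order_tendstoD(2)[OF \<phi>(3), of M] M(1) by (auto simp: eventually_at_top_linorder)
    have "p \<le> q" using \<phi>dec[of q p] p q by (cases "p \<le> q") auto
    then show thesis using IVT2[of \<phi> q M p] p q \<phi>(2) that by (meson DERIV_isCont less_imp_le)
  qed
  obtain R M0 where R: "0 < R" "\<And>x. R < \<bar>x\<bar> \<Longrightarrow> u0 x = 0"
    using admissible_datum_bounds[OF u0] by blast
  define \<psi> where "\<psi> = (\<lambda>x. \<phi> (x - R + x0))"
  have \<psi>': "(\<psi> has_real_derivative - g (\<psi> x)) (at x)" for x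
  proof -
    have "((\<lambda>x. x - R + x0) has_real_derivative 1) (at x)" by (auto intro!: derivative_eq_intros)
    from DERIV_chain2[OF \<phi>(2) this] show ?thesis unfolding \<psi>_def by simp
  qed
  define W where "W = (\<lambda>(t::real) x. if x \<le> R then M else \<psi> x)"
  have W0: "0 < W t x" for t x using M(1) \<phi>(1) by (auto simp: W_def \<psi>_def)
  have super: "supersolution_on d1 d2 \<sigma> f1 f2 0 t1 W" for t1
    unfolding supersolution_on_def
  proof (intro conjI ballI allI)
    have "continuous_on UNIV \<psi>" using \<psi>' by (meson DERIV_isCont continuous_at_imp_continuous_on)
    then have "continuous_on ({0..t1} \<times> {R..}) (\<lambda>(t::real, x). \<psi> x)"
      unfolding split_beta by (rule continuous_on_compose2) (auto intro!: continuous_intros)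
    then show "continuous_on ({0..t1} \<times> UNIV) (\<lambda>(t, x). W t x)"
      unfolding W_def by (intro continuous_on_glue) (auto simp: \<psi>_def x0)
    fix t x :: real
    show "0 \<le> W t x" using W0[of t x] by simp
    consider "x < R" "x \<noteq> 0" | "x = 0" | "x = R" | "R < x" by linarith
    then show "supersolution_at d1 d2 f1 f2 W t x \<or> concave_corner_at \<sigma> (W t) x"
    proof cases
      case 1
      have "has_second_derivative (W t) 0 x"
        unfolding W_def using 1(1) by (intro has_second_derivative_glue_left has_second_derivativeI[of UNIV _ "\<lambda>x. 0"]) auto
      moreover have "((\<lambda>s. W s x) has_real_derivative 0) (at t)" by (simp add: W_def)
      ultimately show ?thesis using 1 M(2,3) unfolding supersolution_at_def
        by (intro disjI1 conjI exI[of _ 0]) (auto simp: W_def)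
    next
      case 2
      have "(W t has_real_derivative 0) (at 0)"
        by (rule has_field_derivative_transform_within_open[of "\<lambda>x. M" _ _ "{..<R}"]) (use R(1) in \<open>auto simp: W_def\<close>)
      then show ?thesis unfolding concave_corner_at_def
        using 2 by (intro disjI2 exI[of _ 0]) (simp add: has_field_derivative_at_within)
    next
      case 3
      have "(W t has_real_derivative 0) (at R within {..R})"
        unfolding W_def by (rule has_derivative_glue_left) simp
      moreover have "(W t has_real_derivative - g (\<psi> R)) (at R within {R..})"
        unfolding W_def
        by (rule has_derivative_glue_right[OF has_field_derivative_at_within[OF \<psi>']]) (simp add: \<psi>_def x0)
      moreover have "0 < g (\<psi> R)" using gpos[OF \<phi>(1)] by (simp add: \<psi>_def)
      ultimately have "concave_corner_at \<sigma> (W t) R"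
        unfolding concave_corner_at_def using R(1)
        by (intro exI[of _ 0] exI[of _ "- g (\<psi> R)"]) auto
      then show ?thesis using 3 by simp
    next
      case 4
      have "\<psi> x < M" using \<phi>dec[of x0 "x - R + x0"] 4 x0 by (simp add: \<psi>_def)
      then have "has_second_derivative \<psi> (- f2 (\<psi> x) / d2) x"
        by (intro second_derivative_of_energy_profile[OF F(1) d(2) \<psi>', of M])
          (use M(4) \<phi>(1) in \<open>auto simp: g_def h_def \<psi>_def\<close>)
      then have "has_second_derivative (W t) (- f2 (\<psi> x) / d2) x"
        unfolding W_def using 4 by (rule has_second_derivative_glue_right)
      moreover have "((\<lambda>s. W s x) has_real_derivative 0) (at t)" by (simp add: W_def)
      ultimately show ?thesis using 4 R(1) d unfolding supersolution_at_def
        by (intro disjI1 conjI exI[of _ 0] exI[of _ "- f2 (\<psi> x) / d2"]) (auto simp: W_def)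
    qed
  qed
  have init: "u 0 x \<le> W 0 x" for x
  proof -
    have "u 0 x = u0 x" using u unfolding solution_of_P_def classical_solution_def by blast
    then show ?thesis using u0M[of x] R(2)[of x] W0[of 0 x] by (cases "x \<le> R") (auto simp: W_def)
  qed
  have uW: "u t x \<le> W t x" if "0 \<le> t" for t x
    by (rule comparison_principle[OF d f u super order_refl init, of _ t]) (use that in simp)
  show ?thesis
  proof (rule blocked_in_patch_2I[OF d f C u0 u])
    fix e :: real assume "e > 0"
    then obtain N where N: "\<And>y. N \<le> y \<Longrightarrow> \<phi> y < e"
      using order_tendstoD(2)[OF \<phi>(3)] by (auto simp: eventually_at_top_linorder)
    have "u t x \<le> e" if "0 \<le> t" "max (R + 1) (N + R - x0) \<le> x" for t x
      using uW[OF that(1), of x] N[of "x - R + x0"] that by (simp add: W_def \<psi>_def)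
    then show "\<exists>T R. \<forall>t\<ge>T. \<forall>x\<ge>R. u t x \<le> e" by blast
  qed
qed

section \<open>The balanced case: a standing wave\<close>

text \<open>
  The standing wave \<open>\<phi>\<close> stays below \<open>K2\<close>, whereas \<open>u\<close> need not, so a correction \<open>q(t)\<close> is added. Near
  the stable values 0 and \<open>K2\<close> the reaction damps \<open>q\<close>, because \<open>f2' < - \<mu>\<close> there. In between, the
  defect \<open>(L + \<mu>) q\<close> is compensated by moving the wave to the right at a speed proportional to \<open>q\<close>,
  using \<open>- \<phi>' \<ge> \<kappa>\<close>. Since \<open>q\<close> decays exponentially, the total displacement \<open>\<Gamma>\<close> is finite.
  In patch 1 the barrier is the trace of the wave at 0. It stays above the midpoint \<open>m\<close> of
  \<open>K1\<close> and \<open>K2\<close>, where \<open>f1\<close> is negative enough to tolerate the decrease of \<open>q\<close>.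
\<close>

lemma blocked_at_balanced_energy:
  assumes d: "0 < d1" "0 < d2" "0 < \<sigma>"
    and f: "f1 C1_differentiable_on UNIV" "f2 C1_differentiable_on UNIV"
    and C: "0 \<le> C" "\<And>s. 0 \<le> s \<Longrightarrow> f1 s \<le> C * s" "\<And>s. 0 \<le> s \<Longrightarrow> f2 s \<le> C * s"
    and u0: "admissible_datum u0" and u: "solution_of_P d1 d2 \<sigma> f1 f2 u0 u"
    and F: "\<And>s. (F has_real_derivative f2 s) (at s)" "F 0 = 0" "F K2 = 0"
    and K: "0 < K1" "K1 < K2" "\<And>s. K1 < s \<Longrightarrow> f1 s < 0" "\<And>s. K2 < s \<Longrightarrow> f2 s < 0"
    and f2: "f2 0 = 0" "f2 K2 = 0" "deriv f2 0 < 0" "deriv f2 K2 < 0"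
    and Fneg: "\<And>s. 0 < s \<Longrightarrow> s < K2 \<Longrightarrow> F s < 0"
  shows "blocked_in_patch_2 u"
proof -
  have K2: "0 < K2" using K by simp
  obtain L where L: "L \<ge> 0" "\<And>x y. x \<in> {0..2 * K2} \<Longrightarrow> y \<in> {0..2 * K2} \<Longrightarrow> \<bar>f2 x - f2 y\<bar> \<le> L * \<bar>x - y\<bar>"
    using C1_Lipschitz_on_interval[OF f(2)] by blast
  define g where "g = (\<lambda>s. sqrt (- 2 * F s / d2))"
  have gpos: "0 < g s" if "s \<in> {0<..<K2}" for s
    using Fneg[of s] that d by (simp add: g_def field_simps)
  have "continuous_on UNIV F" using F(1) by (meson DERIV_isCont continuous_at_imp_continuous_on)
  then have gcont: "continuous_on S g" for S
    unfolding g_def using d by (intro continuous_intros) (auto intro: continuous_on_subset)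
  have "\<exists>\<phi>. (\<forall>x. \<phi> x \<in> {0<..<K2}) \<and> (\<forall>x. (\<phi> has_real_derivative - g (\<phi> x)) (at x)) \<and>
     (\<phi> \<longlongrightarrow> 0) at_top \<and> (\<phi> \<longlongrightarrow> K2) at_bot \<and> antimono \<phi>"
  proof (rule decreasing_profile_exists)
    show "0 < K2" "0 < sqrt (L / d2) + 1" using K2 L d by (auto intro: add_nonneg_pos)
    show "continuous_on {0<..<K2} g" by (rule gcont)
    fix s assume s: "s \<in> {0<..<K2}"
    show "0 < g s" by (rule gpos[OF s])
    have "- (L * s\<^sup>2 / 2) \<le> F s"
    proof (rule energy_bounds[OF F(1,2)])
      fix r assume "0 \<le> r" "r \<le> s"
      then show "- (L * r) \<le> f2 r" using L(2)[of r 0] s f2(1) by (simp add: abs_le_iff)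
    qed (use s in simp)
    then have "g s \<le> sqrt (L / d2) * s" unfolding g_def by (rule energy_slope_bound) (use d s in auto)
    then show "g s \<le> (sqrt (L / d2) + 1) * s" using s by (simp add: distrib_right)
    have "- (L * (K2 - s)\<^sup>2 / 2) \<le> F s"
    proof (rule energy_bounds_top[OF F(1,3)])
      fix r assume "s \<le> r" "r \<le> K2"
      then show "f2 r \<le> L * (K2 - r)" using L(2)[of r K2] s f2(2) by (simp add: abs_le_iff)
    qed (use s in simp)
    then have "g s \<le> sqrt (L / d2) * (K2 - s)" unfolding g_def by (rule energy_slope_bound) (use d s in auto)
    then show "g s \<le> (sqrt (L / d2) + 1) * (K2 - s)" using s by (simp add: distrib_right)
  qed
  then obtain \<phi> where \<phi>: "\<And>x. \<phi> x \<in> {0<..<K2}" "\<And>x. (\<phi> has_real_derivative - g (\<phi> x)) (at x)"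
    "(\<phi> \<longlongrightarrow> 0) at_top" "(\<phi> \<longlongrightarrow> K2) at_bot" "antimono \<phi>" by blast
  obtain f' where f': "\<And>x. (f2 has_real_derivative f' x) (at x)" "continuous_on UNIV f'"
    using C1_real_derivative[OF f(2)] by blast
  define \<mu> where "\<mu> = min (- f' 0) (- f' K2) / 2"
  have f'neg: "f' 0 < 0" "f' K2 < 0" using f2(3,4) DERIV_imp_deriv[OF f'(1)] by auto
  then have \<mu>: "0 < \<mu>" "f' 0 < - \<mu>" "f' K2 < - \<mu>" by (auto simp: \<mu>_def min_def)
  have nbhd: "\<exists>e>0. \<forall>s. \<bar>s - p\<bar> < e \<longrightarrow> f' s < - \<mu>" if "f' p < - \<mu>" for p
  proof -
    have "isCont f' p" using f'(2) by (simp add: continuous_on_eq_continuous_at)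
    then have "(f' \<longlongrightarrow> f' p) (nhds p)" by (simp add: isCont_def tendsto_at_iff_tendsto_nhds)
    then have "\<forall>\<^sub>F s in nhds p. f' s < - \<mu>" using that by (rule order_tendstoD)
    then show ?thesis unfolding eventually_nhds_metric dist_real_def by blast
  qed
  obtain e1 where e1: "0 < e1" "\<And>s. \<bar>s\<bar> < e1 \<Longrightarrow> f' s < - \<mu>" using nbhd[OF \<mu>(2)] by auto
  obtain e2 where e2: "0 < e2" "\<And>s. \<bar>s - K2\<bar> < e2 \<Longrightarrow> f' s < - \<mu>" using nbhd[OF \<mu>(3)] by auto
  \<comment> \<open>Below \<open>\<delta>\<close> or above \<open>K2 - \<delta>\<close>, adding a correction of size at most \<open>\<delta>\<close> does not lead out of the
    neighbourhoods where \<open>f' < - \<mu>\<close>; and \<open>[\<delta>, K2 - \<delta>]\<close> is nonempty.\<close>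
  define \<delta> where "\<delta> = min (min e1 e2) K2 / 3"
  have \<delta>: "0 < \<delta>" "2 * \<delta> < e1" "2 * \<delta> < e2" "3 * \<delta> \<le> K2"
    using e1(1) e2(1) K2 by (auto simp: \<delta>_def)
  have drop: "f2 (s + q) - f2 s \<le> - \<mu> * q"
    if q: "0 \<le> q" "q \<le> \<delta>" and s: "0 < s \<and> s < \<delta> \<or> K2 - \<delta> < s \<and> s < K2" for s q
  proof (cases "q = 0")
    case False
    then obtain z where z: "s < z" "z < s + q" "f2 (s + q) - f2 s = (s + q - s) * f' z"
      using MVT2[of s "s + q" f2 f'] f'(1) q(1) by force
    have "\<bar>z\<bar> < e1 \<or> \<bar>z - K2\<bar> < e2" using s z(1,2) q \<delta> by (auto simp: abs_less_iff)
    then have "f' z < - \<mu>" using e1 e2 by blast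
    then have "q * f' z \<le> q * (- \<mu>)" using q(1) by (intro mult_left_mono) auto
    then show ?thesis using z(3) by (simp add: mult.commute)
  qed simp
  have "\<exists>p\<in>{\<delta>..K2 - \<delta>}. \<forall>s\<in>{\<delta>..K2 - \<delta>}. g p \<le> g s"
    by (rule continuous_attains_inf) (use \<delta> gcont in auto)
  then obtain p where p: "p \<in> {\<delta>..K2 - \<delta>}" "\<And>s. s \<in> {\<delta>..K2 - \<delta>} \<Longrightarrow> g p \<le> g s" by blast
  define \<kappa> where "\<kappa> = g p"
  have \<kappa>: "0 < \<kappa>" using gpos[of p] p(1) \<delta> by (auto simp: \<kappa>_def)
  define m where "m = (K1 + K2) / 2"
  have m: "K1 < m" "m < K2" using K by (auto simp: m_def)
  have f1c: "continuous_on {m..K2 + \<delta>} f1"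
    using f(1) C1_differentiable_imp_continuous_on C1_differentiable_on_subset by blast
  have "\<exists>p\<in>{m..K2 + \<delta>}. \<forall>s\<in>{m..K2 + \<delta>}. f1 s \<le> f1 p"
    by (rule continuous_attains_sup) (use m \<delta> f1c in auto)
  then obtain r where r: "r \<in> {m..K2 + \<delta>}" "\<And>s. s \<in> {m..K2 + \<delta>} \<Longrightarrow> f1 s \<le> f1 r" by blast
  define \<eta> where "\<eta> = - f1 r"
  have \<eta>: "0 < \<eta>" using K(3)[of r] r(1) m by (simp add: \<eta>_def)
  \<comment> \<open>The second bound ensures that \<open>f1\<close> in patch 1 is at most \<open>- \<mu> q0\<close>, the steepest descent of \<open>q\<close>.\<close>
  define q0 where "q0 = min \<delta> (\<eta> / \<mu>)"
  have q0: "0 < q0" "q0 \<le> \<delta>" using \<delta> \<eta> \<mu> by (auto simp: q0_def)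
  have q0\<eta>: "\<mu> * q0 \<le> \<eta>"
  proof -
    have "q0 \<le> \<eta> / \<mu>" by (simp add: q0_def)
    then show ?thesis using \<mu>(1) by (simp add: pos_le_divide_eq mult.commute)
  qed
  obtain T where T: "0 \<le> T" "\<And>x. u T x \<le> K2 + q0 / 2"
  proof (rule eventually_below[OF d f _ _ _ u, of "K2 + q0 / 2"])
    fix s assume "K2 + q0 / 2 \<le> s"
    then show "f1 s < 0" "f2 s < 0" using K q0 by auto
  qed (use K2 q0 in auto)
  obtain A where A: "0 < A" "\<And>x. 0 \<le> x \<Longrightarrow> u T x \<le> A * exp (- x)"
    using finite_time_decay[OF d f C u0 u, of T] T(1) by (metis atLeastAtMost_iff order_refl)
  define R where "R = max 0 (ln (A / q0))"
  have R: "A * exp (- x) \<le> q0" if "R \<le> x" for x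
  proof -
    have "A / q0 \<le> exp x" using that A q0 unfolding R_def by (metis divide_pos_pos exp_le_cancel_iff exp_ln max.bounded_iff)
    then show ?thesis using A q0 by (simp add: exp_minus field_simps)
  qed
  obtain Y where Y: "\<And>y. y \<le> Y \<Longrightarrow> max m (K2 - q0 / 2) < \<phi> y"
    using order_tendstoD(1)[OF \<phi>(4), of "max m (K2 - q0 / 2)"] m q0
    by (auto simp: eventually_at_bot_linorder)
  define \<Gamma> where "\<Gamma> = (L + \<mu>) / (\<kappa> * \<mu>) * q0"
  have \<Gamma>: "0 \<le> \<Gamma>" using L \<mu> \<kappa> q0 by (simp add: \<Gamma>_def)
  \<comment> \<open>The initial position \<open>\<xi>0 - \<Gamma>\<close> puts \<open>\<phi>\<close> above \<open>K2 - q0 / 2\<close> on \<open>x \<le> R\<close>; beyond \<open>R\<close> the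
    correction \<open>q0\<close> alone dominates \<open>u\<close>.\<close>
  define \<xi>0 where "\<xi>0 = R + \<Gamma> - Y"
  define q where "q = (\<lambda>t. q0 * exp (- \<mu> * (t - T)))"
  define \<xi> where "\<xi> = (\<lambda>t. \<xi>0 - \<Gamma> * exp (- \<mu> * (t - T)))"
  have dq: "(q has_real_derivative - \<mu> * q t) (at t)" for t
    unfolding q_def by (auto intro!: derivative_eq_intros)
  have d\<xi>: "(\<xi> has_real_derivative (L + \<mu>) / \<kappa> * q t) (at t)" for t
    unfolding \<xi>_def q_def using \<mu> \<kappa> by (auto intro!: derivative_eq_intros simp: \<Gamma>_def)
  have qpos: "0 < q t" for t using q0 by (simp add: q_def)
  have qle: "q t \<le> q0" and \<xi>le: "\<xi>0 - \<Gamma> \<le> \<xi> t" if "T \<le> t" for t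
  proof -
    have "exp (- \<mu> * (t - T)) \<le> 1" using \<mu> that by simp
    then have "q0 * exp (- \<mu> * (t - T)) \<le> q0 * 1" "\<Gamma> * exp (- \<mu> * (t - T)) \<le> \<Gamma> * 1"
      using q0 \<Gamma> by (intro mult_left_mono; simp)+
    then show "q t \<le> q0" "\<xi>0 - \<Gamma> \<le> \<xi> t" by (simp_all add: q_def \<xi>_def)
  qed
  have \<xi>ge: "\<xi> t \<le> \<xi>0" for t using \<Gamma> by (simp add: \<xi>_def)
  define r where "r = (\<lambda>t x. \<phi> (x - \<xi> t) + q t)"
  define l where "l = (\<lambda>t (x::real). r t 0)"
  let ?w = "\<lambda>t x. if x \<le> 0 then l t x else r t x"
  have dr: "((\<lambda>s. r s x) has_real_derivative g (\<phi> (x - \<xi> t)) * ((L + \<mu>) / \<kappa> * q t) - \<mu> * q t) (at t)" for t x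
  proof -
    have "((\<lambda>s. x - \<xi> s) has_real_derivative - ((L + \<mu>) / \<kappa> * q t)) (at t)"
      by (auto intro!: derivative_eq_intros d\<xi>)
    from DERIV_add[OF DERIV_chain2[OF \<phi>(2) this] dq] show ?thesis unfolding r_def by simp
  qed
  have dx: "((\<lambda>x. \<phi> (x - \<xi> t)) has_real_derivative - g (\<phi> (x - \<xi> t))) (at x)" for t x
  proof -
    have "((\<lambda>x. x - \<xi> t) has_real_derivative 1) (at x)" by (auto intro!: derivative_eq_intros)
    from DERIV_chain2[OF \<phi>(2) this] show ?thesis by simp
  qed
  have shift: "0 \<le> g (\<phi> (x - \<xi> t)) * ((L + \<mu>) / \<kappa> * q t)" for t x
    using gpos[OF \<phi>(1)] L \<mu> \<kappa> qpos by (intro mult_nonneg_nonneg) (auto intro: less_imp_le)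
  have super: "supersolution_on d1 d2 \<sigma> f1 f2 T t1 ?w" for t1
  proof (rule supersolution_glued_at_interface)
    have \<phi>c: "continuous_on UNIV \<phi>" using \<phi>(2) by (meson DERIV_isCont continuous_at_imp_continuous_on)
    have qc: "continuous_on UNIV q" using dq by (meson DERIV_isCont continuous_at_imp_continuous_on)
    have \<xi>c: "continuous_on UNIV \<xi>" using d\<xi> by (meson DERIV_isCont continuous_at_imp_continuous_on)
    have "continuous_on UNIV (\<lambda>p. r (fst p) (snd p))" "continuous_on UNIV (\<lambda>p::real\<times>real. r (fst p) 0)"
      unfolding r_def
      by (intro continuous_on_add continuous_on_compose2[OF \<phi>c] continuous_on_compose2[OF qc]
          continuous_on_diff continuous_on_compose2[OF \<xi>c] continuous_on_fst continuous_on_snd continuous_on_id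
          continuous_on_const subset_UNIV)+
    then show "continuous_on ({T..t1} \<times> {..0}) (\<lambda>(t, x). l t x)" "continuous_on ({T..t1} \<times> {0..}) (\<lambda>(t, x). r t x)"
      unfolding l_def split_beta by (meson continuous_on_subset subset_UNIV)+
    show "l t 0 = r t 0" for t by (simp add: l_def)
    show "0 \<le> l t x" "0 \<le> r t x" for t x
      using \<phi>(1)[of "0 - \<xi> t"] \<phi>(1)[of "x - \<xi> t"] qpos[of t] by (simp_all add: l_def r_def)
  next
    fix t x :: real assume t: "t \<in> {T<..t1}" and x: "x < 0"
    have "m < \<phi> (0 - \<xi> t)" using Y[of "0 - \<xi> t"] \<xi>le[of t] t by (simp add: \<xi>0_def R_def)
    then have "r t 0 \<in> {m..K2 + \<delta>}"
      using \<phi>(1)[of "0 - \<xi> t"] qpos[of t] qle[of t] q0(2) t by (simp add: r_def)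
    then have "f1 (r t 0) \<le> - \<eta>" using \<open>\<And>s. s \<in> {m..K2 + \<delta>} \<Longrightarrow> f1 s \<le> f1 _\<close> by (simp add: \<eta>_def)
    also have "\<dots> \<le> - \<mu> * q t"
    proof -
      have "\<mu> * q t \<le> \<mu> * q0" using qle[of t] t \<mu> by (intro mult_left_mono) auto
      then show ?thesis using q0\<eta> by simp
    qed
    finally have "d1 * 0 + f1 (l t x) \<le> g (\<phi> (0 - \<xi> t)) * ((L + \<mu>) / \<kappa> * q t) - \<mu> * q t"
      using shift[of 0 t] by (simp add: l_def)
    moreover have "has_second_derivative (l t) 0 x"
      unfolding l_def by (rule has_second_derivativeI[of UNIV _ "\<lambda>x. 0"]) auto
    ultimately show "\<exists>D D2. ((\<lambda>s. l s x) has_real_derivative D) (at t) \<and>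
        has_second_derivative (l t) D2 x \<and> d1 * D2 + f1 (l t x) \<le> D"
      using dr[of 0 t] unfolding l_def by blast
  next
    fix t x :: real assume t: "t \<in> {T<..t1}" and x: "0 < x"
    define s where "s = \<phi> (x - \<xi> t)"
    have s: "0 < s" "s < K2" using \<phi>(1) by (auto simp: s_def)
    have q: "0 \<le> q t" "q t \<le> \<delta>" using qpos[of t] qle[of t] q0(2) t by auto
    have "has_second_derivative (\<lambda>x. \<phi> (x - \<xi> t)) (- f2 s / d2) x"
      unfolding s_def by (rule second_derivative_of_energy_profile[OF F(1) d(2) dx, of K2])
        (use Fneg \<phi>(1) in \<open>auto simp: g_def\<close>)
    then have "has_second_derivative (r t) (- f2 s / d2) x"
      unfolding r_def by (rule has_second_derivative_add_const)
    moreover have "d2 * (- f2 s / d2) + f2 (r t x) \<le> g s * ((L + \<mu>) / \<kappa> * q t) - \<mu> * q t"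
    proof -
      have "f2 (s + q t) - f2 s \<le> g s * ((L + \<mu>) / \<kappa> * q t) - \<mu> * q t"
      proof (cases "s < \<delta> \<or> K2 - \<delta> < s")
        case True
        then have "f2 (s + q t) - f2 s \<le> - \<mu> * q t" using drop[OF q] s by blast
        then show ?thesis using shift[of x t] by (simp add: s_def)
      next
        case False
        then have "\<kappa> \<le> g s" using \<open>\<And>s. s \<in> {\<delta>..K2 - \<delta>} \<Longrightarrow> g p \<le> g s\<close> by (simp add: \<kappa>_def)
        then have "\<kappa> * ((L + \<mu>) / \<kappa> * q t) \<le> g s * ((L + \<mu>) / \<kappa> * q t)"
          using L \<mu> \<kappa> q by (intro mult_right_mono) auto
        moreover have "\<kappa> * ((L + \<mu>) / \<kappa> * q t) = (L + \<mu>) * q t" using \<kappa> by simp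
        moreover have "f2 (s + q t) - f2 s \<le> L * q t"
          using L(2)[of "s + q t" s] s q \<delta> by (simp add: abs_le_iff)
        ultimately show ?thesis by (simp add: algebra_simps)
      qed
      then show ?thesis using d by (simp add: r_def s_def)
    qed
    ultimately show "\<exists>D D2. ((\<lambda>s. r s x) has_real_derivative D) (at t) \<and>
        has_second_derivative (r t) D2 x \<and> d2 * D2 + f2 (r t x) \<le> D"
      using dr[of x t] unfolding s_def by blast
  next
    fix t :: real
    have "(l t has_real_derivative 0) (at 0)" by (simp add: l_def)
    moreover have "(r t has_real_derivative - g (\<phi> (0 - \<xi> t))) (at 0)"
      using DERIV_add[OF dx[of t 0] DERIV_const] unfolding r_def by simp
    moreover have "\<sigma> * (- g (\<phi> (0 - \<xi> t))) \<le> 0" using gpos[OF \<phi>(1), of "0 - \<xi> t"] d by simp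
    ultimately show "\<exists>a b. (l t has_real_derivative a) (at 0) \<and>
        (r t has_real_derivative b) (at 0) \<and> \<sigma> * b \<le> a" by blast
  qed
  have init: "u T x \<le> ?w T x" for x
  proof (cases "x \<le> R")
    case True
    have "K2 - q0 / 2 < \<phi> (y - \<xi> T)" if "y \<le> R" for y
      using Y[of "y - \<xi> T"] that by (simp add: \<xi>_def \<xi>0_def)
    then have "K2 + q0 / 2 \<le> r T y" if "y \<le> R" for y using that by (force simp: r_def q_def)
    moreover have "0 \<le> R" by (simp add: R_def)
    ultimately show ?thesis using T(2)[of x] True unfolding l_def by (smt (verit))
  next
    case False
    then have x: "0 < x" "R \<le> x" by (auto simp: R_def)
    then have "u T x \<le> q0" using A(2)[of x] R by force
    also have "\<dots> \<le> r T x" using \<phi>(1)[of "x - \<xi> T"] by (simp add: r_def q_def)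
    finally show ?thesis using x by simp
  qed
  have uw: "u t x \<le> ?w t x" if "T \<le> t" for t x
    by (rule comparison_principle[OF d f u super T(1) init, of _ t]) (use that in simp)
  show ?thesis
  proof (rule blocked_in_patch_2I[OF d f C u0 u])
    fix e :: real assume e: "e > 0"
    then obtain N where N: "\<And>y. N \<le> y \<Longrightarrow> \<phi> y < e / 2"
      using order_tendstoD(2)[OF \<phi>(3), of "e / 2"] by (auto simp: eventually_at_top_linorder)
    define S where "S = T + max 0 (ln (2 * q0 / e) / \<mu>)"
    have qe: "q t \<le> e / 2" if "S \<le> t" for t
    proof -
      have "ln (2 * q0 / e) / \<mu> \<le> t - T" using that by (simp add: S_def)
      then have "ln (2 * q0 / e) \<le> \<mu> * (t - T)" using \<mu>(1) by (simp add: pos_divide_le_eq mult.commute)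
      then have "2 * q0 / e \<le> exp (\<mu> * (t - T))" using q0 e by (metis divide_pos_pos exp_le_cancel_iff exp_ln mult_pos_pos zero_less_numeral)
      moreover have "q t = q0 / exp (\<mu> * (t - T))"
        unfolding q_def mult_minus_left exp_minus by (rule divide_inverse[symmetric])
      moreover have "2 * q0 / exp (\<mu> * (t - T)) \<le> e"
        using calculation(1) e unfolding pos_divide_le_eq[OF exp_gt_zero] pos_divide_le_eq[OF e]
        by (simp add: mult.commute)
      ultimately show ?thesis by (simp add: mult.commute)
    qed
    have "u t x \<le> e" if t: "S \<le> t" and x: "max 1 (N + \<xi>0) \<le> x" for t x
    proof -
      have "\<phi> (x - \<xi> t) \<le> \<phi> (x - \<xi>0)" by (rule antimonoD[OF \<phi>(5)]) (use \<xi>ge[of t] in simp)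
      moreover have "\<phi> (x - \<xi>0) < e / 2" using N x by simp
      moreover have "T \<le> t" using t by (simp add: S_def)
      ultimately show ?thesis using uw[of t x] qe[OF t] x by (simp add: r_def)
    qed
    then show "\<exists>T R. \<forall>t\<ge>T. \<forall>x\<ge>R. u t x \<le> e" by blast
  qed
qed

section \<open>Lower bound for stationary solutions\<close>

text \<open>
  The operator \<open>V'' - c\<^sup>2 V\<close> factors through \<open>p = V' + c V\<close>, and \<open>p exp (- c x)\<close> is nonincreasing. If
  \<open>p\<close> were negative somewhere it would stay so, and \<open>V exp (c x)\<close> would decrease at least linearly
  until it became negative. Hence \<open>p \<ge> 0\<close>, and \<open>V exp (c x)\<close> is nondecreasing. With zero data at 0 one gets
  also \<open>p \<le> 0\<close>, which is the uniqueness statement.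
\<close>

lemma decay_at_most_exponential:
  assumes c: "0 < c" and V: "C2_derivs {0..} V V' V''"
    and le: "\<And>x. 0 < x \<Longrightarrow> V'' x \<le> c\<^sup>2 * V x" and nonneg: "\<And>x. 0 \<le> x \<Longrightarrow> 0 \<le> V x"
  shows "0 \<le> x \<Longrightarrow> V 0 * exp (- c * x) \<le> V x"
    and "V 0 = 0 \<Longrightarrow> V' 0 \<le> 0 \<Longrightarrow> 0 \<le> x \<Longrightarrow> V x = 0"
proof -
  define p where "p = (\<lambda>x. V' x + c * V x)"
  define r where "r = (\<lambda>x. p x * exp (- c * x))"
  define Q where "Q = (\<lambda>x. V x * exp (c * x))"
  have V0: "(V has_real_derivative V' x) (at x within {0..})" "(V' has_real_derivative V'' x) (at x within {0..})"
    if "0 \<le> x" for x using V that unfolding C2_derivs_def by auto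
  have j: "at y within {0..} = at y" if "y > 0" for y :: real
    using that by (intro at_within_interior) simp
  have V1: "(V has_real_derivative V' x) (at x)" "(V' has_real_derivative V'' x) (at x)" if "0 < x" for x
    using V0[of x] j[OF that] that by auto
  have Vc: "continuous_on {0..} V" "continuous_on {0..} V'"
    using V0 by (meson DERIV_continuous_on atLeast_iff)+
  have rc: "continuous_on {0..} r" and Qc: "continuous_on {0..} Q"
    unfolding r_def Q_def p_def by (intro continuous_intros Vc)+
  have dr: "(r has_real_derivative (V'' x - c\<^sup>2 * V x) * exp (- c * x)) (at x)" if "0 < x" for x
    unfolding r_def p_def
    by (auto intro!: derivative_eq_intros V1 that simp: algebra_simps power2_eq_square)
  have dQ: "(Q has_real_derivative p x * exp (c * x)) (at x)" if "0 < x" for x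
    unfolding Q_def p_def by (auto intro!: derivative_eq_intros V1 that simp: algebra_simps)
  have r_dec: "r y \<le> r x" if "0 \<le> x" "x \<le> y" for x y
  proof (rule DERIV_nonpos_imp_decreasing_open[OF that(2)])
    show "continuous_on {x..y} r" using rc that by (auto intro: continuous_on_subset)
    fix z assume "x < z" "z < y"
    then show "\<exists>d. (r has_real_derivative d) (at z) \<and> d \<le> 0"
      using dr[of z] le[of z] that(1) mult_nonpos_nonneg[of "V'' z - c\<^sup>2 * V z" "exp (- c * z)"] by force
  qed
  have p_nonneg: "0 \<le> p x" if x: "0 \<le> x" for x
  proof (rule ccontr)
    assume neg: "\<not> 0 \<le> p x"
    define k where "k = - p x"
    have k: "0 < k" using neg by (simp add: k_def)
    have p_le: "p y \<le> - k" if "x \<le> y" for y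
    proof -
      have "p y * exp (- c * y) \<le> p x * exp (- c * x)" using r_dec[OF x that] by (simp add: r_def)
      also have "\<dots> \<le> p x * exp (- c * y)"
        using neg c that by (intro mult_left_mono_neg) (auto intro: mult_left_mono)
      finally show ?thesis by (simp add: k_def)
    qed
    define y where "y = x + Q x / k + 1"
    have Qx: "0 \<le> Q x" using nonneg[OF x] by (simp add: Q_def)
    have xy: "x < y" using k Qx by (simp add: y_def add_nonneg_pos)
    have "Q y + k * y \<le> Q x + k * x"
    proof (rule DERIV_nonpos_imp_decreasing_open[of x y "\<lambda>z. Q z + k * z"])
      show "continuous_on {x..y} (\<lambda>z. Q z + k * z)"
        using Qc x by (intro continuous_intros) (auto intro: continuous_on_subset)
      fix z assume z: "x < z" "z < y"
      have "((\<lambda>z. Q z + k * z) has_real_derivative p z * exp (c * z) + k) (at z)"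
        using z x by (auto intro!: derivative_eq_intros dQ)
      moreover have "p z * exp (c * z) + k \<le> 0"
      proof -
        have "1 \<le> exp (c * z)" using c z x by simp
        then have "k * 1 \<le> k * exp (c * z)" using k by (intro mult_left_mono) auto
        moreover have "p z * exp (c * z) \<le> - k * exp (c * z)"
          using p_le[of z] z by (intro mult_right_mono) auto
        ultimately show ?thesis by simp
      qed
      ultimately show "\<exists>d. ((\<lambda>z. Q z + k * z) has_real_derivative d) (at z) \<and> d \<le> 0" by blast
    qed (use xy in simp)
    moreover have "k * (y - x) = Q x + k" using k by (simp add: y_def field_simps)
    ultimately have "Q y \<le> - k" by (simp add: algebra_simps)
    moreover have "0 \<le> Q y" using nonneg[of y] x xy by (simp add: Q_def)
    ultimately show False using k by simp
  qed
  have Q_inc: "Q 0 \<le> Q x" if "0 \<le> x" for x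
  proof (rule DERIV_nonneg_imp_increasing_open[OF that])
    show "continuous_on {0..x} Q" using Qc by (auto intro: continuous_on_subset)
    fix z assume "0 < z" "z < x"
    then show "\<exists>d. (Q has_real_derivative d) (at z) \<and> 0 \<le> d"
      using dQ[of z] p_nonneg[of z] mult_nonneg_nonneg[of "p z" "exp (c * z)"] by force
  qed
  show "V 0 * exp (- c * x) \<le> V x" if "0 \<le> x"
    using Q_inc[OF that] by (simp add: Q_def exp_minus field_simps)
  show "V x = 0" if z: "V 0 = 0" "V' 0 \<le> 0" and x: "0 \<le> x"
  proof -
    have "Q x \<le> Q 0"
    proof (rule DERIV_nonpos_imp_decreasing_open[OF x])
      show "continuous_on {0..x} Q" using Qc by (auto intro: continuous_on_subset)
      fix y assume y: "0 < y" "y < x"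
      have "r 0 \<le> 0" using z by (simp add: r_def p_def)
      then have "r y \<le> 0" using r_dec[of 0 y] y by simp
      then have "p y \<le> 0" by (simp add: r_def mult_le_0_iff)
      then show "\<exists>d. (Q has_real_derivative d) (at y) \<and> d \<le> 0"
        using dQ[of y] y mult_nonpos_nonneg[of "p y" "exp (c * y)"] by force
    qed
    then show ?thesis using nonneg[OF x] z by (simp add: Q_def mult_le_0_iff)
  qed
qed

lemma C2_derivs_reflect:
  assumes "C2_derivs {..0} U U' U''"
  shows "C2_derivs {0..} (\<lambda>x. U (- x)) (\<lambda>x. - U' (- x)) (\<lambda>x. U'' (- x))"
proof -
  have im: "uminus ` {0..} = {..0::real}" by (force simp: image_iff)
  have chain: "((\<lambda>x. g (- x)) has_real_derivative - D) (at x within {0..})"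
    if "(g has_real_derivative D) (at (- x) within {..0})" for g :: "real \<Rightarrow> real" and D x
  proof -
    have "(uminus has_real_derivative - 1) (at x within {0..})" by (auto intro!: derivative_eq_intros)
    then show ?thesis using DERIV_image_chain[of g D uminus x "{0..}" "- 1"] that by (simp add: im o_def)
  qed
  show ?thesis
    using assms chain[of U] DERIV_minus[OF chain[of U']]
    unfolding C2_derivs_def
    by (auto intro!: continuous_on_compose2[of "{..0}" U''] continuous_intros)
qed

lemma bounded_above_of_limits:
  fixes U :: "real \<Rightarrow> real"
  assumes "continuous_on UNIV U" "(U \<longlongrightarrow> a) at_bot" "(U \<longlongrightarrow> b) at_top"
  obtains B where "0 < B" "\<And>x. U x \<le> B"
proof -
  obtain p where p: "\<And>x. x \<le> p \<Longrightarrow> U x < a + 1"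
    using order_tendstoD(2)[OF assms(2), of "a + 1"] by (auto simp: eventually_at_bot_linorder)
  obtain q where q: "\<And>x. q \<le> x \<Longrightarrow> U x < b + 1"
    using order_tendstoD(2)[OF assms(3), of "b + 1"] by (auto simp: eventually_at_top_linorder)
  have "compact (U ` {p..q})"
    using assms(1) by (intro compact_continuous_image) (auto intro: continuous_on_subset)
  then obtain B where B: "0 < B" "\<And>x. x \<in> {p..q} \<Longrightarrow> \<bar>U x\<bar> \<le> B"
    by (auto dest!: compact_imp_bounded simp: bounded_pos)
  have "U x \<le> max B (max (a + 1) (b + 1))" for x
    using p[of x] q[of x] B(2)[of x] by (cases "x \<le> p"; cases "q \<le> x") (auto simp: max_def abs_le_iff)
  then show thesis using that[of "max B (max (a + 1) (b + 1))"] B(1) by simp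
qed

text \<open>
  If \<open>U\<close> vanished at 0, it would have a minimum there, with left slope at most 0 and right slope at
  least 0. The transmission condition would make both slopes zero, and \<open>U\<close> would vanish in patch 1,
  against its limit \<open>K1 > 0\<close>. So \<open>U(0) > 0\<close>, and the exponential lower bound holds on both sides.
\<close>

lemma stationary_solution_lower_bound:
  assumes d: "0 < d1" "0 < d2" "0 < \<sigma>"
    and f: "f1 C1_differentiable_on UNIV" "f2 C1_differentiable_on UNIV" "f1 0 = 0" "f2 0 = 0"
    and U: "\<And>x. 0 \<le> U x" "(U \<longlongrightarrow> K1) at_bot" "(U \<longlongrightarrow> b) at_top" "0 < K1"
    and st: "classical_stationary_solution d1 d2 \<sigma> f1 f2 U"
  obtains k c where "0 < k" "0 < c" "\<And>x. k * exp (- c * \<bar>x\<bar>) \<le> U x"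
proof -
  obtain U1' U1'' U2' U2'' where
    C: "C2_derivs {..0} U U1' U1''" "C2_derivs {0..} U U2' U2''"
    and E: "\<And>x. x < 0 \<Longrightarrow> d1 * U1'' x + f1 (U x) = 0" "\<And>x. 0 < x \<Longrightarrow> d2 * U2'' x + f2 (U x) = 0"
    and I: "U1' 0 = \<sigma> * U2' 0" and cont: "continuous_on UNIV U"
    using st unfolding classical_stationary_solution_def by blast
  obtain B where B: "0 < B" "\<And>x. U x \<le> B" using bounded_above_of_limits[OF cont U(2,3)] by blast
  obtain L1 where L1: "L1 \<ge> 0" "\<And>x y. x \<in> {0..B} \<Longrightarrow> y \<in> {0..B} \<Longrightarrow> \<bar>f1 x - f1 y\<bar> \<le> L1 * \<bar>x - y\<bar>"
    using C1_Lipschitz_on_interval[OF f(1)] by blast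
  obtain L2 where L2: "L2 \<ge> 0" "\<And>x y. x \<in> {0..B} \<Longrightarrow> y \<in> {0..B} \<Longrightarrow> \<bar>f2 x - f2 y\<bar> \<le> L2 * \<bar>x - y\<bar>"
    using C1_Lipschitz_on_interval[OF f(2)] by blast
  define c where "c = sqrt (L1 / d1 + L2 / d2 + 1)"
  have sum: "0 \<le> L1 / d1" "0 \<le> L2 / d2" using L1 L2 d by auto
  have c: "0 < c" using sum by (simp add: c_def)
  have c2: "c\<^sup>2 = L1 / d1 + L2 / d2 + 1" using sum by (simp add: c_def)
  have g1: "U1'' x \<le> c\<^sup>2 * U x" if "x < 0" for x
  proof -
    have "- (L1 * U x) \<le> f1 (U x)" using L1(2)[of "U x" 0] U(1)[of x] B f(3) by (simp add: abs_le_iff)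
    then have "d1 * U1'' x \<le> L1 * U x" using E(1)[OF that] by simp
    then have "U1'' x \<le> L1 / d1 * U x" using d by (simp add: field_simps)
    also have "\<dots> \<le> c\<^sup>2 * U x" using sum U(1) unfolding c2 by (intro mult_right_mono) auto
    finally show ?thesis .
  qed
  have g2: "U2'' x \<le> c\<^sup>2 * U x" if "0 < x" for x
  proof -
    have "- (L2 * U x) \<le> f2 (U x)" using L2(2)[of "U x" 0] U(1)[of x] B f(4) by (simp add: abs_le_iff)
    then have "d2 * U2'' x \<le> L2 * U x" using E(2)[OF that] by simp
    then have "U2'' x \<le> L2 / d2 * U x" using d by (simp add: field_simps)
    also have "\<dots> \<le> c\<^sup>2 * U x" using sum U(1) unfolding c2 by (intro mult_right_mono) auto
    finally show ?thesis .
  qed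
  note right = decay_at_most_exponential[OF c C(2) g2 U(1)]
  have left: "0 \<le> x \<Longrightarrow> U 0 * exp (- c * x) \<le> U (- x)"
    "U 0 = 0 \<Longrightarrow> - U1' 0 \<le> 0 \<Longrightarrow> 0 \<le> x \<Longrightarrow> U (- x) = 0" for x
    using decay_at_most_exponential[OF c C2_derivs_reflect[OF C(1)], of x] g1 U(1) by simp_all
  have "U 0 \<noteq> 0"
  proof
    assume 0: "U 0 = 0"
    have "((\<lambda>x. - U x) has_real_derivative - U2' 0) (at 0 within {0..})"
      using C(2) unfolding C2_derivs_def by (auto intro!: DERIV_minus)
    then have "- U2' 0 \<le> 0" by (rule right_derivative_nonpos_at_max) (use 0 U(1) in auto)
    then have "0 \<le> U1' 0" using I d by simp
    then have "U x = 0" if "x \<le> 0" for x using left(2)[OF 0, of "- x"] that by simp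
    then have "\<forall>\<^sub>F x in at_bot. U x = 0" unfolding eventually_at_bot_linorder by blast
    then have "(U \<longlongrightarrow> 0) at_bot" by (rule tendsto_eventually)
    then show False using U(2,4) tendsto_unique[of at_bot U K1 0] by simp
  qed
  then have U0: "0 < U 0" using U(1)[of 0] by simp
  have "U 0 * exp (- c * \<bar>x\<bar>) \<le> U x" for x
    using left(1)[of "- x"] right(1)[of x] by (cases "0 \<le> x") auto
  then show thesis using that U0 c by blast
qed

section \<open>Gaussian supersolutions and small mass\<close>

text \<open>
  The one-dimensional heat kernel without its constant factor \<open>1 / sqrt (4 pi)\<close>.
\<close>

definition gaussian :: "real \<Rightarrow> real \<Rightarrow> real" where
  "gaussian t z = exp (- z\<^sup>2 / (4 * t)) / sqrt t"

lemma gaussian_time_derivative: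
  assumes "0 < t"
  shows "((\<lambda>t. gaussian t z) has_real_derivative (z\<^sup>2 / (4 * t\<^sup>2) - 1 / (2 * t)) * gaussian t z) (at t)"
proof -
  have "sqrt t * sqrt t = t" using assms by simp
  then show ?thesis unfolding gaussian_def using assms
    by (auto intro!: derivative_eq_intros simp: field_simps power2_eq_square)
qed

lemma gaussian_space_derivative:
  assumes "0 < t"
  shows "(gaussian t has_real_derivative - (z / (2 * t)) * gaussian t z) (at z)"
  unfolding gaussian_def[abs_def] using assms
  by (auto intro!: derivative_eq_intros simp: field_simps)

text \<open>
  The equation \<open>w\<^sub>t = d w\<^sub>x\<^sub>x + C w\<close> at one point, in a form that is stable under linear combinations.
\<close>

definition solves_linear :: "real \<Rightarrow> real \<Rightarrow> (real \<Rightarrow> real \<Rightarrow> real) \<Rightarrow> real \<Rightarrow> real \<Rightarrow> bool" where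
  "solves_linear d C w t x \<longleftrightarrow>
     (\<exists>D2. ((\<lambda>s. w s x) has_real_derivative d * D2 + C * w t x) (at t) \<and> has_second_derivative (w t) D2 x)"

lemma solves_linear_add:
  assumes "solves_linear d C v t x" "solves_linear d C w t x"
  shows "solves_linear d C (\<lambda>t x. v t x + w t x) t x"
proof -
  obtain D where v: "((\<lambda>s. v s x) has_real_derivative d * D + C * v t x) (at t)" "has_second_derivative (v t) D x"
    using assms(1) unfolding solves_linear_def by blast
  obtain E where w: "((\<lambda>s. w s x) has_real_derivative d * E + C * w t x) (at t)" "has_second_derivative (w t) E x"
    using assms(2) unfolding solves_linear_def by blast
  have "has_second_derivative (\<lambda>x. v t x + w t x) (D + E) x"
    using has_second_derivative_diff[OF v(2) has_second_derivative_cmult[OF w(2), of "- 1"]] by simp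
  moreover have "((\<lambda>s. v s x + w s x) has_real_derivative d * (D + E) + C * (v t x + w t x)) (at t)"
    using DERIV_add[OF v(1) w(1)] by (simp add: algebra_simps)
  ultimately show ?thesis unfolding solves_linear_def by blast
qed

lemma solves_linear_cmult:
  assumes "solves_linear d C v t x"
  shows "solves_linear d C (\<lambda>t x. c * v t x) t x"
proof -
  obtain D where v: "((\<lambda>s. v s x) has_real_derivative d * D + C * v t x) (at t)" "has_second_derivative (v t) D x"
    using assms(1) unfolding solves_linear_def by blast
  have "((\<lambda>s. c * v s x) has_real_derivative d * (c * D) + C * (c * v t x)) (at t)"
    using DERIV_cmult[OF v(1), of c] by (simp add: algebra_simps)
  then show ?thesis
    using has_second_derivative_cmult[OF v(2), of c] unfolding solves_linear_def by blast
qed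

lemma solves_linear_sum:
  fixes n :: nat
  assumes "\<And>i. i < n \<Longrightarrow> solves_linear d C (w i) t x"
  shows "solves_linear d C (\<lambda>t x. \<Sum>i<n. w i t x) t x"
  using assms
proof (induction n)
  case 0
  have "has_second_derivative (\<lambda>x. 0) 0 x"
    by (rule has_second_derivativeI[of UNIV _ "\<lambda>x. 0"]) auto
  then show ?case unfolding solves_linear_def by (intro exI[of _ 0]) simp
next
  case (Suc n)
  then show ?case using solves_linear_add[of d C "\<lambda>t x. \<Sum>i<n. w i t x" t x "w n"] by simp
qed

lemma solves_linear_gaussian:
  assumes s: "0 < s" and t: "0 < t + \<tau>"
  shows "solves_linear (s\<^sup>2) C (\<lambda>t x. exp (C * t) * gaussian (t + \<tau>) (x / s + \<eta>)) t x"
proof -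
  define z where "z = x / s + \<eta>"
  define \<theta> where "\<theta> = t + \<tau>"
  have \<theta>: "0 < \<theta>" using t by (simp add: \<theta>_def)
  define D where "D = (z\<^sup>2 / (4 * \<theta>\<^sup>2) - 1 / (2 * \<theta>)) * gaussian \<theta> z"
  have inner: "((\<lambda>x. x / s + \<eta>) has_real_derivative 1 / s) (at x)" for x
    using s by (auto intro!: derivative_eq_intros)
  have g1: "((\<lambda>x. gaussian \<theta> (x / s + \<eta>)) has_real_derivative
      - ((x / s + \<eta>) / (2 * \<theta>)) * gaussian \<theta> (x / s + \<eta>) * (1 / s)) (at x)" for x
    using DERIV_chain2[OF gaussian_space_derivative[OF \<theta>] inner] .
  have g2: "((\<lambda>x. - ((x / s + \<eta>) / (2 * \<theta>)) * gaussian \<theta> (x / s + \<eta>) * (1 / s)) has_real_derivative D / s\<^sup>2) (at x)"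
  proof -
    have "((\<lambda>z. - (z / (2 * \<theta>)) * gaussian \<theta> z) has_real_derivative D) (at z)"
      using \<theta> by (auto intro!: derivative_eq_intros gaussian_space_derivative simp: D_def field_simps power2_eq_square)
    from DERIV_cmult_right[OF DERIV_chain2[OF this[unfolded z_def] inner], of "1 / s"]
    show ?thesis by (simp add: power2_eq_square)
  qed
  have "has_second_derivative (\<lambda>x. gaussian \<theta> (x / s + \<eta>)) (D / s\<^sup>2) x"
    by (rule has_second_derivativeI[of UNIV, OF g1 _ _ g2]) auto
  then have "has_second_derivative (\<lambda>x. exp (C * t) * gaussian \<theta> (x / s + \<eta>)) (exp (C * t) * (D / s\<^sup>2)) x"
    by (rule has_second_derivative_cmult)
  moreover have "((\<lambda>t. gaussian (t + \<tau>) z) has_real_derivative D) (at t)"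
  proof -
    have "((\<lambda>t. t + \<tau>) has_real_derivative 1) (at t)" by (auto intro!: derivative_eq_intros)
    then show ?thesis
      using DERIV_chain2[of "\<lambda>t. gaussian t z" D "\<lambda>t. t + \<tau>" t 1] gaussian_time_derivative[OF \<theta>, of z]
      by (simp add: D_def \<theta>_def)
  qed
  then have "((\<lambda>t. exp (C * t) * gaussian (t + \<tau>) z) has_real_derivative
      s\<^sup>2 * (exp (C * t) * (D / s\<^sup>2)) + C * (exp (C * t) * gaussian (t + \<tau>) z)) (at t)"
    using s by (auto intro!: derivative_eq_intros)
  ultimately show ?thesis unfolding solves_linear_def z_def \<theta>_def by blast
qed

lemma left_Riemann_sum_le:
  fixes S :: "real \<Rightarrow> real"
  assumes "continuous_on {0..real k * h} S" "0 \<le> h"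
    "\<And>x y. x \<in> {0..real k * h} \<Longrightarrow> y \<in> {0..real k * h} \<Longrightarrow> \<bar>x - y\<bar> \<le> h \<Longrightarrow> S y \<le> S x + e"
  shows "(\<Sum>i<k. h * S (real i * h)) \<le> integral {0..real k * h} S + real k * h * e"
  using assms(1,3)
proof (induction k)
  case (Suc k)
  define p where "p = real k * h"
  have p: "real (Suc k) * h = p + h" "0 \<le> p" using assms(2) by (auto simp: p_def algebra_simps)
  have sub: "{0..p} \<subseteq> {0..p + h}" "{p..p + h} \<subseteq> {0..p + h}" using assms(2) p by auto
  have c: "continuous_on {0..p + h} S" using Suc.prems(1) p by simp
  have int: "S integrable_on {0..p + h}" using integrable_continuous_real[OF c] .
  have "integral {p..p + h} (\<lambda>x. S p - e) \<le> integral {p..p + h} S"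
  proof (rule integral_le)
    show "S integrable_on {p..p + h}"
      using c sub(2) by (intro integrable_continuous_real) (auto intro: continuous_on_subset)
    fix x assume "x \<in> {p..p + h}"
    then show "S p - e \<le> S x" using Suc.prems(2)[of x p] p assms(2) by (simp add: abs_le_iff)
  qed (intro integrable_continuous_real continuous_on_const)
  then have "h * S p \<le> integral {p..p + h} S + h * e" using assms(2) by (simp add: algebra_simps)
  moreover have "(\<Sum>i<k. h * S (real i * h)) \<le> integral {0..p} S + real k * h * e"
    unfolding p_def
  proof (rule Suc.IH)
    show "continuous_on {0..real k * h} S" using c sub(1) unfolding p_def by (rule continuous_on_subset)
    fix x y assume "x \<in> {0..real k * h}" "y \<in> {0..real k * h}" "\<bar>x - y\<bar> \<le> h"
    then show "S y \<le> S x + e" using Suc.prems(2)[of x y] sub(1) p by (auto simp: p_def)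
  qed
  moreover have "integral {0..p} S + integral {p..p + h} S = integral {0..p + h} S"
    by (rule Henstock_Kurzweil_Integration.integral_combine[OF _ _ int]) (use p assms(2) in auto)
  ultimately show ?case unfolding p(1) by (simp add: algebra_simps p_def)
qed simp

text \<open>
  Partition \<open>[0, b]\<close> into cells of length \<open>h\<close> and put at each left endpoint a Gaussian of width \<open>h\<close>, so
  \<open>\<tau> = h\<^sup>2\<close>. On its own cell such a Gaussian is at least \<open>exp (- 1/4) / h\<close>, so the weight
  \<open>exp (1/4) h S\<close>, raised by the oscillation \<open>e\<close> of \<open>S\<close> on a cell, makes it dominate \<open>S\<close> there. The total weight
  is a Riemann sum. Working with finitely many Gaussians avoids differentiating under an integral
  and the passage to the limit of a heat flow at its initial time.
\<close>

lemma gaussian_majorant: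
  fixes S :: "real \<Rightarrow> real"
  assumes b: "0 < b" and S: "continuous_on {0..b} S" "\<And>x. x \<in> {0..b} \<Longrightarrow> 0 \<le> S x"
    and m: "integral {0..b} S < m"
  shows "\<exists>(n::nat) c \<eta> \<tau>. 0 < \<tau> \<and> \<tau> \<le> 1 \<and> (\<forall>i<n. 0 \<le> c i \<and> \<eta> i \<in> {0..b}) \<and>
     (\<Sum>i<n. c i) \<le> exp (1/4) * m \<and> (\<forall>x\<in>{0..b}. S x \<le> (\<Sum>i<n. c i * gaussian \<tau> (x - \<eta> i)))"
proof -
  define e where "e = (m - integral {0..b} S) / (2 * b)"
  have e: "0 < e" "integral {0..b} S + 2 * b * e = m" using m b by (auto simp: e_def)
  have "uniformly_continuous_on {0..b} S" using S(1) by (intro compact_uniformly_continuous) auto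
  then obtain \<delta> where \<delta>: "0 < \<delta>" "\<And>x y. x \<in> {0..b} \<Longrightarrow> y \<in> {0..b} \<Longrightarrow> \<bar>x - y\<bar> < \<delta> \<Longrightarrow> \<bar>S x - S y\<bar> < e"
    using e(1) unfolding uniformly_continuous_on_def dist_real_def by (metis abs_minus_commute)
  obtain n :: nat where n: "b / min \<delta> 1 < real n" using reals_Archimedean2 by blast
  have n0: "0 < n" using n b \<delta>(1) by (metis divide_pos_pos gr0I less_numeral_extra(1) min_less_iff_conj not_less_iff_gr_or_eq of_nat_0 order_less_trans)
  define h where "h = b / real n"
  have "b < real n * min \<delta> 1" using n \<delta>(1) by (simp add: pos_divide_less_eq)
  then have h: "0 < h" "h < \<delta>" "h < 1" "real n * h = b"
  proof -
    have "h < min \<delta> 1" using \<open>b < real n * min \<delta> 1\<close> n0 pos_divide_less_eq[of "real n" b "min \<delta> 1"]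
      by (simp only: h_def mult.commute of_nat_0_less_iff)
    then show "h < \<delta>" "h < 1" by simp_all
  qed (use b n0 in \<open>simp_all add: h_def\<close>)
  have close: "S y \<le> S x + e" if "x \<in> {0..b}" "y \<in> {0..b}" "\<bar>x - y\<bar> \<le> h" for x y
    using \<delta>(2)[OF that(1,2)] that(3) h(2) by (simp add: abs_if split: if_splits)
  have grid: "real i * h \<in> {0..b}" if "i < n" for i
    using that h mult_right_mono[of "real i" "real n" h] by auto
  define c where "c = (\<lambda>i. exp (1/4) * (h * (S (real i * h) + e)))"
  have c0: "0 \<le> c i" if "i < n" for i
    using S(2)[OF grid[OF that]] e h unfolding c_def by (intro mult_nonneg_nonneg) auto
  have "(\<Sum>i<n. h * S (real i * h)) \<le> integral {0..b} S + b * e"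
    using left_Riemann_sum_le[of n h S e] S(1) h close by simp
  moreover have "(\<Sum>i<n. c i) = exp (1/4) * ((\<Sum>i<n. h * S (real i * h)) + b * e)"
    unfolding c_def sum_distrib_left[symmetric] distrib_left sum.distrib by (simp add: h(4)[symmetric])
  moreover have "exp (1/4) * ((\<Sum>i<n. h * S (real i * h)) + b * e) \<le> exp (1/4) * m"
    using calculation(1) e(2) by (intro mult_left_mono) auto
  ultimately have "(\<Sum>i<n. c i) \<le> exp (1/4) * m" by simp
  moreover have "S x \<le> (\<Sum>i<n. c i * gaussian (h\<^sup>2) (x - real i * h))" if x: "x \<in> {0..b}" for x
  proof -
    define j where "j = min (nat \<lfloor>x / h\<rfloor>) (n - 1)"
    have j: "j < n" using n0 by (simp add: j_def)
    have xh: "0 \<le> x / h" "x / h \<le> real n" using x h by (auto simp: pos_divide_le_eq)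
    have fl: "real (nat \<lfloor>x / h\<rfloor>) \<le> x / h" "x / h \<le> real (nat \<lfloor>x / h\<rfloor>) + 1" using xh(1) by linarith+
    have "real j \<le> x / h" "x / h \<le> real j + 1"
      using fl xh(2) n0 by (auto simp: j_def min_def of_nat_diff)
    then have "real j * h \<le> x" "x \<le> real j * h + h" using h(1) by (auto simp: field_simps)
    then have xj: "\<bar>x - real j * h\<bar> \<le> h" "\<bar>real j * h - x\<bar> \<le> h" by auto
    have "S x \<le> S (real j * h) + e" using close[OF grid[OF j] x] xj by simp
    also have "\<dots> = c j * (exp (- (1/4)) / h)" using h by (simp add: c_def exp_minus field_simps)
    also have "\<dots> \<le> c j * gaussian (h\<^sup>2) (x - real j * h)"
    proof (rule mult_left_mono[OF _ c0[OF j]])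
      have "(x - real j * h)\<^sup>2 \<le> h\<^sup>2" using xj(1) by (metis abs_le_square_iff abs_of_pos h(1))
      then have "- (1/4) \<le> - (x - real j * h)\<^sup>2 / (4 * h\<^sup>2)" using h(1) by (simp add: field_simps)
      then show "exp (- (1/4)) / h \<le> gaussian (h\<^sup>2) (x - real j * h)"
        using h(1) by (simp add: gaussian_def divide_right_mono)
    qed
    also have "\<dots> \<le> (\<Sum>i<n. c i * gaussian (h\<^sup>2) (x - real i * h))"
      by (rule member_le_sum) (use j c0 in \<open>auto simp: gaussian_def\<close>)
    finally show ?thesis .
  qed
  ultimately show ?thesis
    using c0 grid h(1,3) by (intro exI[of _ n] exI[of _ c] exI[of _ "\<lambda>i. real i * h"] exI[of _ "h\<^sup>2"])
      (auto simp: power_le_one)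
qed

lemma scaled_integral_le_L1_norm:
  fixes u0 :: "real \<Rightarrow> real"
  assumes u0: "continuous_on UNIV u0" "\<And>x. 0 \<le> u0 x" "\<And>x. x \<notin> {- L..L} \<Longrightarrow> u0 x = 0" and s: "s \<noteq> 0"
  shows "integral {0..b} (\<lambda>x. u0 (s * x)) \<le> (1 / \<bar>s\<bar>) * (LINT x|lborel. \<bar>u0 x\<bar>)"
proof -
  have "integrable lborel (\<lambda>x. indicator {- L..L} x *\<^sub>R u0 x)"
    by (rule borel_integrable_compact) (use u0 in \<open>auto intro: continuous_on_subset\<close>)
  moreover have "(\<lambda>x. indicator {- L..L} x *\<^sub>R u0 x) = u0" using u0(3) by (auto simp: indicator_def fun_eq_iff)
  ultimately have int: "integrable lborel u0" by simp
  have int': "integrable lborel (\<lambda>x. u0 (s * x))"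
    using lborel_integrable_real_affine[OF int s, of 0] by simp
  have "set_integrable lborel {0..b} (\<lambda>x. u0 (s * x))"
    unfolding set_integrable_def using int' by (intro integrable_mult_indicator) auto
  then have "integral {0..b} (\<lambda>x. u0 (s * x)) = (LINT x:{0..b}|lborel. u0 (s * x))"
    by (rule set_borel_integral_eq_integral(2)[symmetric])
  also have "\<dots> \<le> (LINT x|lborel. u0 (s * x))"
    unfolding set_lebesgue_integral_def
    by (rule integral_mono') (use int' u0(2) in \<open>auto simp: indicator_def\<close>)
  also have "\<dots> = (1 / \<bar>s\<bar>) * (LINT x|lborel. u0 x)"
    using lborel_integral_real_affine[OF s, of u0 0] s by (simp add: field_simps)
  finally show ?thesis using u0(2) by simp
qed

text \<open>
  In the variable \<open>\<xi> = x / sqrt d\<^sub>i\<close> an even solution of the heat equation, multiplied by \<open>exp (C t)\<close>,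
  solves \<open>w\<^sub>t = d\<^sub>i w\<^sub>x\<^sub>x + C w\<close> in patch \<open>i\<close> with zero slope at the interface, so nonnegative ones are
  supersolutions. Folding \<open>u\<^sub>0\<close>
  onto the half-line as \<open>S\<close> gives an even majorant at time 0. At time 1 the Gaussian tails, centred
  in \<open>[- b, b]\<close>, lie below any exponential up to a constant factor. Zero slope
  also makes \<open>\<sigma>\<close> disappear from the construction, so \<open>\<epsilon>\<close> can be chosen before \<open>\<sigma>\<close>.
\<close>

lemma small_mass_below_exponential:
  fixes k c L :: real
  assumes d: "0 < d1" "0 < d2"
    and f: "f1 C1_differentiable_on UNIV" "f2 C1_differentiable_on UNIV"
    and C: "0 \<le> C" "\<And>s. 0 \<le> s \<Longrightarrow> f1 s \<le> C * s" "\<And>s. 0 \<le> s \<Longrightarrow> f2 s \<le> C * s"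
    and k: "0 < k" and L: "0 < L"
  shows "\<exists>\<epsilon>>0. \<forall>\<sigma>>0. \<forall>u0 u. admissible_datum u0 \<and> solution_of_P d1 d2 \<sigma> f1 f2 u0 u \<and>
      closure {x. u0 x \<noteq> 0} \<subseteq> {-L..L} \<and> (LINT x|lborel. \<bar>u0 x\<bar>) \<le> \<epsilon>
      \<longrightarrow> (\<forall>x. u 1 x \<le> k * exp (- c * \<bar>x\<bar>))"
proof -
  define s1 where "s1 = sqrt d1"
  define s2 where "s2 = sqrt d2"
  have s: "0 < s1" "0 < s2" "s1\<^sup>2 = d1" "s2\<^sup>2 = d2" using d by (auto simp: s1_def s2_def)
  define b where "b = L / s1 + L / s2"
  have b: "0 < b" "L \<le> b * s1" "L \<le> b * s2"
    using L s by (auto simp: b_def distrib_right intro: add_pos_pos)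
  define J where "J = 1 / s1 + 1 / s2"
  have J: "0 < J" using s by (simp add: J_def add_pos_pos)
  define Q where "Q = exp (4 * c\<^sup>2 * (d1 + d2))"
  define A where "A = exp C * (2 * exp (b\<^sup>2 / 8) * Q) * exp (1/4) * (2 * J)"
  have A: "0 < A" using J by (simp add: A_def Q_def)
  define \<epsilon> where "\<epsilon> = k / A"
  have \<epsilon>: "0 < \<epsilon>" using k A by (simp add: \<epsilon>_def)
  have main: "u 1 x \<le> k * exp (- c * \<bar>x\<bar>)"
    if \<sigma>: "0 < \<sigma>" and adm: "admissible_datum u0" and u: "solution_of_P d1 d2 \<sigma> f1 f2 u0 u"
      and supp: "closure {x. u0 x \<noteq> 0} \<subseteq> {-L..L}" and small: "(LINT x|lborel. \<bar>u0 x\<bar>) \<le> \<epsilon>"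
    for \<sigma> u0 u x
  proof -
    have u0: "continuous_on UNIV u0" "\<And>x. 0 \<le> u0 x" using adm unfolding admissible_datum_def by auto
    have out: "u0 x = 0" if "x \<notin> {-L..L}" for x
      using that supp closure_subset[of "{x. u0 x \<noteq> 0}"] by blast
    define S where "S = (\<lambda>\<xi>. u0 (- s1 * \<xi>) + u0 (s2 * \<xi>))"
    have Sc: "continuous_on X S" for X
      unfolding S_def by (intro continuous_intros continuous_on_compose2[OF u0(1)]) auto
    have "integral {0..b} S = integral {0..b} (\<lambda>x. u0 (- s1 * x)) + integral {0..b} (\<lambda>x. u0 (s2 * x))"
      unfolding S_def
      by (intro integral_add integrable_continuous_real continuous_on_compose2[OF u0(1)] continuous_intros) auto
    also have "\<dots> \<le> (1 / s1) * (LINT x|lborel. \<bar>u0 x\<bar>) + (1 / s2) * (LINT x|lborel. \<bar>u0 x\<bar>)"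
      using scaled_integral_le_L1_norm[where L = L and s = "- s1" and b = b, OF u0 out]
        scaled_integral_le_L1_norm[where L = L and s = s2 and b = b, OF u0 out] s
      by (intro add_mono) auto
    also have "\<dots> = J * (LINT x|lborel. \<bar>u0 x\<bar>)" by (simp add: J_def algebra_simps)
    also have "\<dots> \<le> J * \<epsilon>" using small J by (intro mult_left_mono) auto
    also have "\<dots> < 2 * J * \<epsilon>" using J \<epsilon> by simp
    finally have "integral {0..b} S < 2 * J * \<epsilon>" .
    then have "\<exists>(n::nat) a \<eta> \<tau>. 0 < \<tau> \<and> \<tau> \<le> 1 \<and> (\<forall>i<n. 0 \<le> a i \<and> \<eta> i \<in> {0..b}) \<and>
        (\<Sum>i<n. a i) \<le> exp (1/4) * (2 * J * \<epsilon>) \<and>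
        (\<forall>x\<in>{0..b}. S x \<le> (\<Sum>i<n. a i * gaussian \<tau> (x - \<eta> i)))"
      by (intro gaussian_majorant[OF b(1) Sc]) (auto simp: S_def u0(2))
    then obtain n :: nat and a \<eta> \<tau> where
      \<tau>: "0 < \<tau>" "\<tau> \<le> 1" and a: "\<And>i. i < n \<Longrightarrow> 0 \<le> a i" "\<And>i. i < n \<Longrightarrow> \<eta> i \<in> {0..b}"
      "(\<Sum>i<n. a i) \<le> exp (1/4) * (2 * J * \<epsilon>)"
      and maj: "\<And>x. x \<in> {0..b} \<Longrightarrow> S x \<le> (\<Sum>i<n. a i * gaussian \<tau> (x - \<eta> i))"
      by blast
    define W where "W = (\<lambda>s t x. \<Sum>i<n. a i * (exp (C * t) * gaussian (t + \<tau>) (x / s + \<eta> i)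
        + exp (C * t) * gaussian (t + \<tau>) (x / s + - \<eta> i)))"
    have lin: "solves_linear (s\<^sup>2) C (W s) t x" if "0 < s" "0 < t" for s t x
      unfolding W_def
      by (intro solves_linear_sum solves_linear_cmult solves_linear_add solves_linear_gaussian) (use that \<tau> in auto)
    have W0: "0 \<le> W s t x" if "0 \<le> t" for s t x
      unfolding W_def using a(1) that \<tau> by (intro sum_nonneg mult_nonneg_nonneg add_nonneg_nonneg) (auto simp: gaussian_def)
    have Wx: "(W s t has_real_derivative 0) (at 0)" if "0 < s" "0 < t" for s t
    proof -
      have \<theta>: "0 < t + \<tau>" using that \<tau> by simp
      define D where "D = (\<lambda>\<eta>. - (\<eta> / (2 * (t + \<tau>))) * gaussian (t + \<tau>) \<eta> * (1 / s))"
      have g: "((\<lambda>x. gaussian (t + \<tau>) (x / s + \<eta>)) has_real_derivative D \<eta>) (at 0)" for \<eta>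
      proof -
        have "((\<lambda>x. x / s + \<eta>) has_real_derivative 1 / s) (at 0)" using that by (auto intro!: derivative_eq_intros)
        moreover have "(gaussian (t + \<tau>) has_real_derivative - (\<eta> / (2 * (t + \<tau>))) * gaussian (t + \<tau>) \<eta>) (at (0 / s + \<eta>))"
          using gaussian_space_derivative[OF \<theta>, of \<eta>] by simp
        ultimately show ?thesis
          unfolding D_def by (metis DERIV_chain2)
      qed
      have "(W s t has_real_derivative (\<Sum>i<n. a i * (exp (C * t) * D (\<eta> i) + exp (C * t) * D (- \<eta> i)))) (at 0)"
        unfolding W_def by (intro DERIV_sum DERIV_cmult DERIV_add g)
      moreover have "D (- \<eta>) = - D \<eta>" for \<eta> by (simp add: D_def gaussian_def)
      ultimately show ?thesis by simp
    qed
    have Wc: "continuous_on ({0..1} \<times> X) (\<lambda>(t, x). W s t x)" for s X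
      unfolding W_def gaussian_def split_beta divide_inverse
      by (intro continuous_on_sum continuous_on_mult continuous_on_add continuous_on_exp continuous_on_minus
          continuous_on_power continuous_on_inverse continuous_on_real_sqrt continuous_on_const
          continuous_on_fst continuous_on_snd continuous_on_id) (use \<tau> in auto)
    let ?w = "\<lambda>t x. if x \<le> 0 then W s1 t x else W s2 t x"
    have super: "supersolution_on d1 d2 \<sigma> f1 f2 0 1 ?w"
    proof (rule supersolution_glued_at_interface)
      show "continuous_on ({0..1} \<times> {..0}) (\<lambda>(t, x). W s1 t x)" "continuous_on ({0..1} \<times> {0..}) (\<lambda>(t, x). W s2 t x)"
        by (rule Wc)+
      show "W s1 t 0 = W s2 t 0" for t by (simp add: W_def)
      show "0 \<le> W s1 t x" "0 \<le> W s2 t x" if "t \<in> {0..1}" for t x using W0 that by auto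
    next
      fix t x :: real assume t: "t \<in> {0<..1}"
      obtain D where "((\<lambda>s. W s1 s x) has_real_derivative d1 * D + C * W s1 t x) (at t)" "has_second_derivative (W s1 t) D x"
        using lin[OF s(1), of t x] t s unfolding solves_linear_def by auto
      moreover have "f1 (W s1 t x) \<le> C * W s1 t x" using C(2) W0 t by simp
      ultimately show "\<exists>D D2. ((\<lambda>s. W s1 s x) has_real_derivative D) (at t) \<and>
        has_second_derivative (W s1 t) D2 x \<and> d1 * D2 + f1 (W s1 t x) \<le> D" by (meson add_left_mono)
      obtain D where "((\<lambda>s. W s2 s x) has_real_derivative d2 * D + C * W s2 t x) (at t)" "has_second_derivative (W s2 t) D x"
        using lin[OF s(2), of t x] t s unfolding solves_linear_def by auto
      moreover have "f2 (W s2 t x) \<le> C * W s2 t x" using C(3) W0 t by simp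
      ultimately show "\<exists>D D2. ((\<lambda>s. W s2 s x) has_real_derivative D) (at t) \<and>
        has_second_derivative (W s2 t) D2 x \<and> d2 * D2 + f2 (W s2 t x) \<le> D" by (meson add_left_mono)
    next
      fix t :: real assume "t \<in> {0<..1}"
      then show "\<exists>a b. (W s1 t has_real_derivative a) (at 0) \<and> (W s2 t has_real_derivative b) (at 0) \<and> \<sigma> * b \<le> a"
        using Wx[OF s(1), of t] Wx[OF s(2), of t] by (intro exI[of _ 0]) simp
    qed
    have even: "W s t (- x) = W s t x" for s t x
    proof -
      have g: "gaussian (t + \<tau>) (- (x / s) + y) = gaussian (t + \<tau>) (x / s + - y)" for y
      proof -
        have "- (x / s) + y = - (x / s + - y)" by simp
        then show ?thesis unfolding gaussian_def by (simp only: power2_minus)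
      qed
      show ?thesis unfolding W_def
        by (intro sum.cong refl) (use g g[of "- _"] in \<open>simp add: add.commute\<close>)
    qed
    have maj': "S \<xi> \<le> W s 0 (s * \<xi>)" if "0 < s" "\<xi> \<in> {0..b}" for s \<xi>
    proof -
      have "(\<Sum>i<n. a i * gaussian \<tau> (\<xi> - \<eta> i)) \<le> W s 0 (s * \<xi>)"
        unfolding W_def using a(1) that \<tau> by (intro sum_mono mult_left_mono) (auto simp: gaussian_def)
      then show ?thesis using maj[OF that(2)] by simp
    qed
    have init: "u 0 x \<le> ?w 0 x" for x
    proof -
      have ux: "u 0 x = u0 x" using u unfolding solution_of_P_def classical_solution_def by blast
      consider "x \<notin> {-L..L}" | "x \<in> {-L..L}" "x \<le> 0" | "x \<in> {-L..L}" "0 < x" by linarith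
      then show ?thesis
      proof cases
        case 1
        then show ?thesis using ux out W0[of 0] by simp
      next
        case 2
        define \<xi> where "\<xi> = - x / s1"
        have "\<xi> \<in> {0..b}" "x = - s1 * \<xi>" "s1 * \<xi> = - x"
          using 2 s(1) b(2) by (auto simp: \<xi>_def field_simps)
        then have "u0 x \<le> W s1 0 (- x)" using maj'[OF s(1), of \<xi>] u0(2)[of "s2 * \<xi>"] by (simp add: S_def)
        then show ?thesis using 2 ux even by simp
      next
        case 3
        define \<xi> where "\<xi> = x / s2"
        have "\<xi> \<in> {0..b}" "x = s2 * \<xi>"
          using 3 s(2) b(3) by (auto simp: \<xi>_def field_simps)
        then have "u0 x \<le> W s2 0 x" using maj'[OF s(2), of \<xi>] u0(2)[of "- s1 * \<xi>"] by (simp add: S_def)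
        then show ?thesis using 3 ux by simp
      qed
    qed
    have late: "W s 1 x \<le> k * exp (- c * \<bar>x\<bar>)" if s0: "0 < s" "s\<^sup>2 \<le> d1 + d2" for s
    proof -
      define \<xi> where "\<xi> = x / s"
      define E where "E = exp (b\<^sup>2 / 8) * (Q * exp (- c * \<bar>x\<bar>))"
      have gE: "gaussian (1 + \<tau>) (\<xi> + y) \<le> E" if y: "\<bar>y\<bar> \<le> b" for y
      proof -
        have "gaussian (1 + \<tau>) (\<xi> + y) \<le> exp (- (\<xi> + y)\<^sup>2 / (4 * (1 + \<tau>)))"
          unfolding gaussian_def using \<tau> by (simp add: divide_le_eq)
        also have "\<dots> \<le> exp (b\<^sup>2 / 8 + (4 * c\<^sup>2 * (d1 + d2) - c * \<bar>x\<bar>))"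
        proof -
          define q where "q = (\<xi> + y)\<^sup>2 / (4 * (1 + \<tau>))"
          have "(\<xi> + y)\<^sup>2 / 8 \<le> q"
            unfolding q_def using \<tau> by (intro divide_left_mono) auto
          moreover have "0 \<le> (\<xi> + 2 * y)\<^sup>2" by simp
          then have "\<xi>\<^sup>2 / 2 - y\<^sup>2 \<le> (\<xi> + y)\<^sup>2" by (simp add: power2_eq_square algebra_simps)
          moreover have "y\<^sup>2 \<le> b\<^sup>2" using y b(1) by (metis abs_le_square_iff abs_of_pos)
          moreover have "c * \<bar>x\<bar> \<le> \<xi>\<^sup>2 / 16 + 4 * c\<^sup>2 * s\<^sup>2"
          proof -
            have x: "\<bar>x\<bar> = s * \<bar>\<xi>\<bar>" using s0(1) by (simp add: \<xi>_def)
            have "(\<bar>\<xi>\<bar> / 4 - 2 * c * s)\<^sup>2 = \<xi>\<^sup>2 / 16 + 4 * c\<^sup>2 * s\<^sup>2 - c * \<bar>x\<bar>"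
              unfolding x by (simp add: power2_diff power_mult_distrib power_divide)
            \<comment> \<open>Completing the square: the Gaussian exponent \<open>\<xi>\<^sup>2 / 16\<close> beats \<open>c \<bar>x\<bar>\<close> up to \<open>4 c\<^sup>2 s\<^sup>2\<close>.\<close>
            moreover have "0 \<le> (\<bar>\<xi>\<bar> / 4 - 2 * c * s)\<^sup>2" by simp
            ultimately show ?thesis by linarith
          qed
          moreover have "4 * c\<^sup>2 * s\<^sup>2 \<le> 4 * c\<^sup>2 * (d1 + d2)" using s0(2) by (intro mult_left_mono) auto
          ultimately have "- q \<le> b\<^sup>2 / 8 + (4 * c\<^sup>2 * (d1 + d2) - c * \<bar>x\<bar>)" by linarith
          then have "- (\<xi> + y)\<^sup>2 / (4 * (1 + \<tau>)) \<le> b\<^sup>2 / 8 + (4 * c\<^sup>2 * (d1 + d2) - c * \<bar>x\<bar>)"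
            unfolding q_def minus_divide_left .
          then show ?thesis unfolding exp_le_cancel_iff .
        qed
        also have "\<dots> = E"
          unfolding E_def Q_def exp_add[symmetric] by (simp only: mult_minus_left add_uminus_conv_diff)
        finally show ?thesis .
      qed
      have "W s 1 x \<le> (\<Sum>i<n. a i * (exp C * E + exp C * E))"
        unfolding W_def \<xi>_def[symmetric]
      proof (intro sum_mono mult_left_mono add_mono)
        fix i assume "i \<in> {..<n}"
        then have i: "i < n" "\<bar>\<eta> i\<bar> \<le> b" "\<bar>- \<eta> i\<bar> \<le> b" using a(2)[of i] by auto
        show "exp (C * 1) * gaussian (1 + \<tau>) (\<xi> + \<eta> i) \<le> exp C * E"
          "exp (C * 1) * gaussian (1 + \<tau>) (\<xi> + - \<eta> i) \<le> exp C * E"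
          using gE[OF i(2)] gE[OF i(3)] by simp_all
        show "0 \<le> a i" by (rule a(1)[OF i(1)])
      qed
      also have "\<dots> = (2 * exp C * E) * (\<Sum>i<n. a i)" by (simp add: sum_distrib_left mult_ac)
      also have "\<dots> \<le> (2 * exp C * E) * (exp (1/4) * (2 * J * \<epsilon>))"
        using a(3) by (intro mult_left_mono) (auto simp: E_def Q_def)
      also have "\<dots> = (A * \<epsilon>) * exp (- c * \<bar>x\<bar>)" by (simp add: A_def E_def mult_ac)
      also have "A * \<epsilon> = k" using A by (simp add: \<epsilon>_def)
      finally show ?thesis .
    qed
    have "u 1 x \<le> ?w 1 x"
      by (rule comparison_principle[OF d \<sigma> f u super order_refl init]) simp
    also have "\<dots> \<le> k * exp (- c * \<bar>x\<bar>)" using late[OF s(1)] late[OF s(2)] s d by (cases "x \<le> 0") simp_all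
    finally show ?thesis .
  qed
  show ?thesis by (rule exI[of _ \<epsilon>]) (use \<epsilon> main in blast)
qed

lemma blocked_below_stationary_solution:
  assumes d: "0 < d1" "0 < d2" "0 < \<sigma>"
    and f: "f1 C1_differentiable_on UNIV" "f2 C1_differentiable_on UNIV"
    and C: "0 \<le> C" "\<And>s. 0 \<le> s \<Longrightarrow> f1 s \<le> C * s" "\<And>s. 0 \<le> s \<Longrightarrow> f2 s \<le> C * s"
    and u0: "admissible_datum u0" and u: "solution_of_P d1 d2 \<sigma> f1 f2 u0 u"
    and U: "\<And>x. 0 \<le> U x" "(U \<longlongrightarrow> 0) at_top" "classical_stationary_solution d1 d2 \<sigma> f1 f2 U"
    and T: "0 \<le> T" and below: "\<And>x. u T x \<le> U x"
  shows "blocked_in_patch_2 u"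
proof -
  obtain U1' U1'' U2' U2'' where
    D: "C2_derivs {..0} U U1' U1''" "C2_derivs {0..} U U2' U2''"
    and E: "\<And>x. x < 0 \<Longrightarrow> d1 * U1'' x + f1 (U x) = 0" "\<And>x. 0 < x \<Longrightarrow> d2 * U2'' x + f2 (U x) = 0"
    and I: "U1' 0 = \<sigma> * U2' 0" and cont: "continuous_on UNIV U"
    using U(3) unfolding classical_stationary_solution_def by blast
  have i: "at y within {..0} = at y" if "y < 0" for y :: real
    using that by (intro at_within_interior) simp
  have j: "at y within {0..} = at y" if "y > 0" for y :: real
    using that by (intro at_within_interior) simp
  have left: "(U has_real_derivative U1' y) (at y)" "(U1' has_real_derivative U1'' y) (at y)" if "y < 0" for y
    using D(1) that i[OF that] unfolding C2_derivs_def by (metis atMost_iff less_imp_le)+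
  have right: "(U has_real_derivative U2' y) (at y)" "(U2' has_real_derivative U2'' y) (at y)" if "0 < y" for y
    using D(2) that j[OF that] unfolding C2_derivs_def by (metis atLeast_iff less_imp_le)+
  have super: "supersolution_on d1 d2 \<sigma> f1 f2 T t1 (\<lambda>t. U)" for t1
    unfolding supersolution_on_def
  proof (intro conjI ballI allI)
    show "continuous_on ({T..t1} \<times> UNIV) (\<lambda>(t, x). U x)"
      unfolding split_beta by (rule continuous_on_compose2[OF cont]) (auto intro!: continuous_intros)
    fix t x :: real
    show "0 \<le> U x" by (rule U(1))
    consider "x < 0" | "x = 0" | "0 < x" by linarith
    then show "supersolution_at d1 d2 f1 f2 (\<lambda>t. U) t x \<or> concave_corner_at \<sigma> U x"
    proof cases
      case 1
      have "has_second_derivative U (U1'' x) x"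
        by (rule has_second_derivativeI[of "{..<0}" _ U1']) (use left 1 in simp_all)
      then show ?thesis using 1 E(1) unfolding supersolution_at_def by force
    next
      case 3
      have "has_second_derivative U (U2'' x) x"
        by (rule has_second_derivativeI[of "{0<..}" _ U2']) (use right 3 in simp_all)
      then show ?thesis using 3 E(2) unfolding supersolution_at_def by force
    next
      case 2
      have "concave_corner_at \<sigma> U 0"
        unfolding concave_corner_at_def
        by (rule exI[of _ "U1' 0"], rule exI[of _ "U2' 0"]) (use D I in \<open>auto simp: C2_derivs_def I[symmetric]\<close>)
      then show ?thesis using 2 by simp
    qed
  qed
  have uU: "u t x \<le> U x" if "T \<le> t" for t x
    by (rule comparison_principle[OF d f u super T below, of _ t]) (use that in simp)
  show ?thesis
  proof (rule blocked_in_patch_2I[OF d f C u0 u])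
    fix e :: real assume "e > 0"
    then obtain N where "\<And>x. N \<le> x \<Longrightarrow> U x < e"
      using order_tendstoD(2)[OF U(2)] by (auto simp: eventually_at_top_linorder)
    then have "\<forall>t\<ge>T. \<forall>x\<ge>N. u t x \<le> e" using uU by (meson less_imp_le order_trans)
    then show "\<exists>T R. \<forall>t\<ge>T. \<forall>x\<ge>R. u t x \<le> e" by blast
  qed
qed

section \<open>Blocking\<close>

text \<open>
  Compactness of the support turns the pointwise strict bound into a gap.
\<close>

lemma bounded_away_below:
  assumes "admissible_datum u0" "\<forall>x. u0 x < \<theta>" "K < \<theta>"
  shows "\<exists>M. K \<le> M \<and> M < \<theta> \<and> (\<forall>x. u0 x \<le> M)"
proof -
  obtain R where R: "0 < R" "\<And>x. R < \<bar>x\<bar> \<Longrightarrow> u0 x = 0"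
    using admissible_datum_bounds[OF assms(1)] by blast
  have "continuous_on {- R..R} u0"
    using assms(1) unfolding admissible_datum_def by (auto intro: continuous_on_subset)
  then have "\<exists>p\<in>{- R..R}. \<forall>x\<in>{- R..R}. u0 x \<le> u0 p"
    using R(1) by (intro continuous_attains_sup) auto
  then obtain p where p: "\<And>x. x \<in> {- R..R} \<Longrightarrow> u0 x \<le> u0 p" by blast
  have "0 \<le> u0 p" using assms(1) unfolding admissible_datum_def by blast
  then have "u0 x \<le> u0 p" for x
    using p[of x] R(2)[of x] by (cases "x \<in> {- R..R}") auto
  then show ?thesis using assms(2,3) by (intro exI[of _ "max K (u0 p)"]) (auto simp: le_max_iff_disj)
qed

theorem theorem2p11:
  fixes d1 d2 K1 K2 \<theta> :: real and f1 f2 :: "real \<Rightarrow> real"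
  assumes "0 < d1" and "0 < d2" and "0 < K1" and "0 < K2"
    and "f1 C1_differentiable_on UNIV" and "f2 C1_differentiable_on UNIV"
    and "f1 0 = 0" and "f1 K1 = 0"
    and "\<forall>s. 0 < s \<and> s < K1 \<longrightarrow> 0 < f1 s \<and> f1 s \<le> deriv f1 0 * s"
    and "deriv f1 K1 < 0"
    and "\<forall>s. s < 0 \<or> K1 < s \<longrightarrow> f1 s < 0"
    and "0 < \<theta>" and "\<theta> < K2"
    and "f2 0 = 0" and "f2 \<theta> = 0" and "f2 K2 = 0"
    and "deriv f2 0 < 0" and "0 < deriv f2 \<theta>" and "deriv f2 K2 < 0"
    and "\<forall>s. (0 < s \<and> s < \<theta>) \<or> K2 < s \<longrightarrow> f2 s < 0"
    and "\<forall>s. s < 0 \<or> (\<theta> < s \<and> s < K2) \<longrightarrow> 0 < f2 s"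
  shows
    "(\<forall>\<sigma>>0. \<forall>u0 u.
        admissible_datum u0 \<and> solution_of_P d1 d2 \<sigma> f1 f2 u0 u \<and>
        (integral {0..K2} f2 < 0 \<or>
         (integral {0..K2} f2 = 0 \<and> K1 < K2) \<or>
         (K1 < \<theta> \<and> (\<forall>x. u0 x < \<theta>)))
        \<longrightarrow> blocked_in_patch_2 u)
     \<and>
     (\<forall>U L. 0 < L \<and> (\<forall>x. 0 \<le> U x) \<and> (U \<longlongrightarrow> K1) at_bot \<and> (U \<longlongrightarrow> 0) at_top \<longrightarrow>
        (\<exists>\<epsilon>>0. \<forall>\<sigma>>0. classical_stationary_solution d1 d2 \<sigma> f1 f2 U \<longrightarrow>
           (\<forall>u0 u.
              admissible_datum u0 \<and> solution_of_P d1 d2 \<sigma> f1 f2 u0 u \<and>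
              closure {x. u0 x \<noteq> 0} \<subseteq> {-L..L} \<and>
              (LINT x|lborel. \<bar>u0 x\<bar>) \<le> \<epsilon>
              \<longrightarrow> blocked_in_patch_2 u)))"
proof -
  note d = assms(1,2) and f = assms(5,6)
  have f1neg: "f1 s < 0" if "K1 < s" for s using assms(11) that by blast
  have f2neg: "f2 s < 0" if "0 < s \<and> s < \<theta> \<or> K2 < s" for s using assms(20) that by blast
  obtain C1 where C1: "C1 \<ge> 0" "\<And>s. 0 \<le> s \<Longrightarrow> f1 s \<le> C1 * s"
    using sublinear_bound[OF f(1) assms(7), of K1] f1neg less_imp_le by metis
  obtain C2 where C2: "C2 \<ge> 0" "\<And>s. 0 \<le> s \<Longrightarrow> f2 s \<le> C2 * s"
    using sublinear_bound[OF f(2) assms(14), of K2] f2neg less_imp_le by metis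
  define C where "C = max C1 C2"
  have C: "0 \<le> C" "\<And>s. 0 \<le> s \<Longrightarrow> f1 s \<le> C * s" "\<And>s. 0 \<le> s \<Longrightarrow> f2 s \<le> C * s"
  proof -
    show "0 \<le> C" using C1(1) by (simp add: C_def)
    fix s :: real assume s: "0 \<le> s"
    have "C1 * s \<le> C * s" "C2 * s \<le> C * s" using s by (auto simp: C_def intro: mult_right_mono)
    then show "f1 s \<le> C * s" "f2 s \<le> C * s" using C1(2)[OF s] C2(2)[OF s] by linarith+
  qed
  have "continuous_on UNIV f2" using f(2) by (rule C1_differentiable_imp_continuous_on)
  then obtain F where F: "\<And>s. (F has_real_derivative f2 s) (at s)" "F 0 = 0"
    and FK: "F K2 = integral {0..K2} f2"
    using antiderivative_exists[of f2] assms(4) by (metis less_imp_le)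
  have Fneg: "F s < 0" if "F K2 \<le> 0" "0 < s" "s < K2" for s
    by (rule bistable_energy_negative[OF F assms(12,13) that(1) _ _ that(2,3)]) (use f2neg assms(21) in auto)
  show ?thesis
  proof (intro conjI allI impI; elim conjE)
    fix \<sigma> u0 u
    assume \<sigma>: "0 < \<sigma>" and u0: "admissible_datum u0" and u: "solution_of_P d1 d2 \<sigma> f1 f2 u0 u"
      and cond: "integral {0..K2} f2 < 0 \<or> (integral {0..K2} f2 = 0 \<and> K1 < K2) \<or>
         (K1 < \<theta> \<and> (\<forall>x. u0 x < \<theta>))"
    obtain M0 R where M0: "\<And>x. u0 x \<le> M0" using admissible_datum_bounds[OF u0] by blast
    from cond show "blocked_in_patch_2 u"
    proof (elim disjE conjE)
      assume neg: "integral {0..K2} f2 < 0"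
      define M where "M = max M0 (max K1 K2)"
      show ?thesis
      proof (rule blocked_below_negative_energy[OF d \<sigma> f C u0 u F assms(14), of M])
        show "0 < M" "u0 x \<le> M" for x using assms(4) M0[of x] by (auto simp: M_def)
        have "K1 \<le> M" "K2 \<le> M" by (auto simp: M_def)
        then show "f1 M \<le> 0" "f2 M \<le> 0"
          using f1neg[of M] f2neg[of M] assms(8,16) unfolding order_le_less by auto
        fix s :: real assume s: "0 < s" "s \<le> M"
        show "F s < 0"
        proof (cases "s < K2")
          case True
          then show ?thesis using Fneg s neg FK by simp
        next
          case False
          have "F s \<le> F K2"
          proof (rule DERIV_nonpos_imp_decreasing_open[of K2 s F])
            show "K2 \<le> s" using False by simp
            show "continuous_on {K2..s} F"
              using F(1) by (meson DERIV_isCont continuous_at_imp_continuous_on)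
            show "\<exists>y. (F has_real_derivative y) (at x) \<and> y \<le> 0" if "K2 < x" "x < s" for x
              using F(1)[of x] f2neg[of x] that by force
          qed
          then show ?thesis using neg FK by simp
        qed
      qed
    next
      assume "integral {0..K2} f2 = 0" "K1 < K2"
      then show ?thesis
        using blocked_at_balanced_energy[OF d \<sigma> f C u0 u F _ assms(3) _ f1neg _ assms(14,16,17,19)]
          FK Fneg f2neg by auto
    next
      assume K1: "K1 < \<theta>" and below: "\<forall>x. u0 x < \<theta>"
      obtain M where M: "K1 \<le> M" "M < \<theta>" "\<And>x. u0 x \<le> M"
        using bounded_away_below[OF u0 below K1] by blast
      show ?thesis
      proof (rule blocked_below_negative_energy[OF d \<sigma> f C u0 u F assms(14) _ _ _ _ M(3)])
        show "0 < M" using M(1) assms(3) by simp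
        show "f1 M \<le> 0" using f1neg[of M] assms(8) M(1) unfolding order_le_less by auto
        show "f2 M \<le> 0" using f2neg[of M] M assms(3) by simp
        fix s :: real assume s: "0 < s" "s \<le> M"
        have "F s < F 0"
        proof (rule DERIV_neg_imp_decreasing_open[OF s(1)])
          show "continuous_on {0..s} F"
            using F(1) by (meson DERIV_isCont continuous_at_imp_continuous_on)
          show "\<exists>y. (F has_real_derivative y) (at x) \<and> y < 0" if "0 < x" "x < s" for x
            using F(1)[of x] f2neg[of x] that s M(2) by force
        qed
        then show "F s < 0" using F(2) by simp
      qed
    qed
  next
    fix U :: "real \<Rightarrow> real" and L :: real
    assume L: "0 < L" and U: "\<forall>x. 0 \<le> U x" "(U \<longlongrightarrow> K1) at_bot" "(U \<longlongrightarrow> 0) at_top"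
    show "\<exists>\<epsilon>>0. \<forall>\<sigma>>0. classical_stationary_solution d1 d2 \<sigma> f1 f2 U \<longrightarrow>
           (\<forall>u0 u.
              admissible_datum u0 \<and> solution_of_P d1 d2 \<sigma> f1 f2 u0 u \<and>
              closure {x. u0 x \<noteq> 0} \<subseteq> {-L..L} \<and>
              (LINT x|lborel. \<bar>u0 x\<bar>) \<le> \<epsilon>
              \<longrightarrow> blocked_in_patch_2 u)"
    \<comment> \<open>The lower bound for \<open>U\<close> holds as soon as \<open>U\<close> is stationary for some \<open>\<sigma>\<close>, and its constants then serve for all \<open>\<sigma>\<close>.\<close>
    proof (cases "\<exists>\<sigma>>0. classical_stationary_solution d1 d2 \<sigma> f1 f2 U")
      case True
      then obtain \<sigma>0 where "0 < \<sigma>0" "classical_stationary_solution d1 d2 \<sigma>0 f1 f2 U" by blast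
      then obtain k c where kc: "0 < k" "\<And>x. k * exp (- c * \<bar>x\<bar>) \<le> U x"
        using stationary_solution_lower_bound[OF d _ f assms(7,14) _ U(2,3) assms(3)] U(1) by metis
      obtain \<epsilon> where \<epsilon>: "0 < \<epsilon>" and small: "\<And>\<sigma> u0 u x. 0 < \<sigma> \<Longrightarrow> admissible_datum u0 \<Longrightarrow>
          solution_of_P d1 d2 \<sigma> f1 f2 u0 u \<Longrightarrow> closure {x. u0 x \<noteq> 0} \<subseteq> {-L..L} \<Longrightarrow>
          (LINT x|lborel. \<bar>u0 x\<bar>) \<le> \<epsilon> \<Longrightarrow> u 1 x \<le> k * exp (- c * \<bar>x\<bar>)"
        using small_mass_below_exponential[OF d f C kc(1) L, of c] by blast
      have "blocked_in_patch_2 u"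
        if \<sigma>: "0 < \<sigma>" and st: "classical_stationary_solution d1 d2 \<sigma> f1 f2 U"
          and u0: "admissible_datum u0" and u: "solution_of_P d1 d2 \<sigma> f1 f2 u0 u"
          and data: "closure {x. u0 x \<noteq> 0} \<subseteq> {-L..L}" "(LINT x|lborel. \<bar>u0 x\<bar>) \<le> \<epsilon>" for \<sigma> u0 u
      proof (rule blocked_below_stationary_solution[OF d \<sigma> f C u0 u _ U(3) st, of 1])
        show "u 1 x \<le> U x" for x using small[OF \<sigma> u0 u data, of x] kc(2)[of x] by linarith
      qed (use U(1) in auto)
      then show ?thesis using \<epsilon> by blast
    next
      case False
      then show ?thesis by (intro exI[of _ 1]) auto
    qed
  qed
qed

end
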